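(* Let $(M^{2m+1},H,J,\theta)$ be a pseudo-Hermitian manifold. Assume that there exists a non-negative $C^2$ function $\gamma$ on $M$ satisfying: (i) $\lim_{x\to\infty}\gamma(x)=+\infty$, i.e. for all $\eta>0$ there is a compact set $K_\eta\subset M$ such that $\gamma(x)>\eta$ whenever $x\notin K_\eta$; (ii) $|\nabla^H\gamma|\leq A\gamma^{\frac12}$ outside some compact subset of $M$; (iii) $\Delta_b\gamma\leq B\gamma^{\frac12}G(\gamma^{\frac12})^{\frac12}$ outside some compact subset of $M$; where $A,B$ are two positive constants and $G$ is a smooth function on $[0,+\infty)$ with $G(0)>0$, $G'\geq0$, $G^{-\frac12}\notin L^1(+\infty)$, and $\limsup_{t\to+\infty}\frac{tG(t^{\frac12})}{G(t)}<+\infty$. Then for every $C^2$ function $u:M\to\mathbb{R}$ which is bounded from above, there exists a sequence $\{x_k\}\subset M$ such that $$\lim_{k\to\infty}u(x_k)=\sup_Mu,\qquad \lim_{k\to\infty}|\nabla^Hu(x_k)|=0,\qquad \limsup_{k\to\infty}\Delta_bu(x_k)\leq0.$$ If, instead of (ii), we assume that $|\nabla\gamma|\leq A\gamma^{\frac12}$ outside some compact subset of $M$, then the second conclusion can be strengthened to $\lim_{k\to\infty}|\nabla u(x_k)|=0$. If, instead of (iii), we suppose that, outside some compact subset of $M$, $\mathrm{Re}\,\nabla d\gamma(X,\overline X)\leq B\gamma^{\frac12}G(\gamma^{\frac12})^{\frac12}|X|^2$ for every $X\in T_{1,0}M$, then the third conclusion can be strengthened to $\limsup_{k\to\infty}\mathrm{Re}\,\nabla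 du(Y_k,\overline{Y_k})\leq0$ for every $Y_k\in T_{1,0}M_{x_k}$ with $|Y_k|=1$.
   Context: Pseudo-Hermitian manifolds: $M$ is a connected, second countable, orientable smooth real manifold of dimension $2m+1$ with a complex rank-$m$ subbundle $T_{1,0}M\subset TM\otimes\mathbb{C}$ such that, with $T_{0,1}M=\overline{T_{1,0}M}$, $T_{1,0}M\cap T_{0,1}M=\{0\}$ and $[\Gamma(T_{1,0}M),\Gamma(T_{1,0}M)]\subseteq\Gamma(T_{1,0}M)$; $T_{1,0}M_x$ denotes its fiber at $x$. $H=\mathrm{Re}\{T_{1,0}M\oplus T_{0,1}M\}$ is the Levi distribution, with complex structure $J(X+\overline X)=\sqrt{-1}(X-\overline X)$ for $X\in T_{1,0}M$. $\theta$ is a global nowhere vanishing real 1-form with $\ker\theta=H$ whose Levi form $L_\theta(X,Y)=d\theta(X,JY)$, $X,Y\in H$, is positive definite. The exterior derivative is normalized by $d\theta(X,Y)=\frac12\big(X\theta(Y)-Y\theta(X)-\theta([X,Y])\big)$. The Reeb field $\xi$ is the unique vector field with $\theta(\xi)=1$, $d\theta(\xi,\cdot)=0$; $TM=H\oplus\mathbb{R}\xi$ with projection $\pi_H:TM\to H$; $J$ is extended by $J\xi=0$. The Webster metric is $g_\theta(X,Y)=L_\theta(\pi_HX,\pi_HY)+\theta(X)\theta(Y)$, extended complex bilinearly; for complex $X$, $|X|^2=g_\theta(X,\overline X)$. The Tanaka-Webster connection $\nabla$ is the unique linear connection with: $\nabla_X\Gamma(H)\subset\Gamma(H)$ for all $X$;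 $\nabla J=0$, $\nabla g_\theta=0$; and torsion satisfying $T_\nabla(X,Y)=2d\theta(X,Y)\xi$ and $T_\nabla(\xi,JX)+JT_\nabla(\xi,X)=0$ for $X,Y\in H$. For a $C^2$ function $u$: $\nabla u$ is the gradient with respect to $g_\theta$, $\nabla^Hu=\pi_H\nabla u$ is the horizontal gradient; $(\nabla du)(Y,Z)=Y(Zu)-(\nabla_YZ)u$; for a local unitary frame $\{\eta_k\}$ of $T_{1,0}M$, $u_{k\bar l}=(\nabla du)(\eta_k,\overline{\eta_l})$ and $u_{\bar lk}=(\nabla du)(\overline{\eta_l},\eta_k)$; the sub-Laplacian is $\Delta_bu=\mathrm{trace}_H(\nabla du)=\sum_k(u_{k\bar k}+u_{\bar kk})$; and for $X=\sum_kX^k\eta_k\in T_{1,0}M$, with $X^{\bar l}=\overline{X^l}$, $$\mathrm{Re}\,\nabla du(X,\overline X)=\frac12\sum_{k,l=1}^m\left(u_{k\bar l}X^kX^{\bar l}+\overline{u_{k\bar l}X^kX^{\bar l}}\right).$$ $G^{-1/2}\notin L^1(+\infty)$ means that $G^{-1/2}$ is not integrable at $+\infty$. *)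

theory Defs
  imports "HOL-Analysis.Analysis"
begin

section \<open>Smooth manifolds\<close>

text \<open>The derivatives are taken within \<open>S\<close>, so that the same notion covers open sets and the closed
  half-line \<open>{0..}\<close> (one-sided derivatives at the end point). In finite dimension it is enough
  that all directional components of the derivative are \<open>C\<^sup>k\<close>.\<close>

primrec Ck_on :: "nat \<Rightarrow> 'e::real_normed_vector set \<Rightarrow> ('e \<Rightarrow> 'b::real_normed_vector) \<Rightarrow> bool" where
  "Ck_on 0 S f \<longleftrightarrow> continuous_on S f"
| "Ck_on (Suc k) S f \<longleftrightarrow>
     (\<forall>x\<in>S. f differentiable (at x within S)) \<and>
     (\<forall>v. Ck_on k S (\<lambda>x. frechet_derivative f (at x within S) v))"

definition smooth_on :: "'e::real_normed_vector set \<Rightarrow> ('e \<Rightarrow> 'b::real_normed_vector) \<Rightarrow> bool" where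
  "smooth_on S f \<longleftrightarrow> (\<forall>k. Ck_on k S f)"

text \<open>The manifold is the whole type \<open>'a\<close>. A chart is a domain together with a map whose values off
  the domain are irrelevant.\<close>

type_synonym ('a, 'n) chart = "'a set \<times> ('a \<Rightarrow> real ^ 'n)"

definition chart_inv :: "('a, 'n::finite) chart \<Rightarrow> real ^ 'n \<Rightarrow> 'a" where
  "chart_inv c = inv_into (fst c) (snd c)"

definition is_chart :: "('a::topological_space, 'n::finite) chart \<Rightarrow> bool" where
  "is_chart c \<longleftrightarrow> open (fst c) \<and> open (snd c ` fst c) \<and>
     homeomorphism (fst c) (snd c ` fst c) (snd c) (chart_inv c)"

definition smooth_atlas :: "('a::topological_space, 'n::finite) chart set \<Rightarrow> bool" where
  "smooth_atlas A \<longleftrightarrow> (\<forall>c\<in>A. is_chart c) \<and> (\<Union>c\<in>A. fst c) = UNIV \<and>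
     (\<forall>c\<in>A. \<forall>d\<in>A. smooth_on (snd c ` (fst c \<inter> fst d)) (snd d \<circ> chart_inv c))"

text \<open>The atlas \<open>A\<close> need not be maximal, hence the oriented atlas \<open>B\<close> is only required to be compatible
  with it.\<close>

definition orientable_atlas :: "('a::topological_space, 'n::finite) chart set \<Rightarrow> bool" where
  "orientable_atlas A \<longleftrightarrow> (\<exists>B. smooth_atlas B \<and> smooth_atlas (A \<union> B) \<and>
     (\<forall>c\<in>B. \<forall>d\<in>B. \<forall>x \<in> fst c \<inter> fst d.
        det (matrix (frechet_derivative (snd d \<circ> chart_inv c) (at (snd c x)))) > 0))"

text \<open>The tangent space at \<open>x\<close> is identified with \<open>real ^ 'n\<close> through one chart chosen at \<open>x\<close>; so
  tangent vectors at \<open>x\<close> are elements of \<open>real ^ 'n\<close> and vector fields are functions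
  \<open>'a \<Rightarrow> real ^ 'n\<close>. The chosen chart varies discontinuously with \<open>x\<close>; smoothness of a field is
  therefore always expressed through its components \<open>field_in_chart\<close> in a fixed chart.\<close>

definition chart_at :: "('a, 'n::finite) chart set \<Rightarrow> 'a \<Rightarrow> ('a, 'n) chart" where
  "chart_at A x = (SOME c. c \<in> A \<and> x \<in> fst c)"

text \<open>\<open>tdiff A f x v\<close> is the differential of \<open>f\<close> at \<open>x\<close> applied to the tangent vector \<open>v\<close>, that is
  \<open>v f\<close> for real-valued \<open>f\<close>.\<close>

definition tdiff ::
  "('a, 'n::finite) chart set \<Rightarrow> ('a \<Rightarrow> 'b::real_normed_vector) \<Rightarrow> 'a \<Rightarrow> real ^ 'n \<Rightarrow> 'b" where
  "tdiff A f x v =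
     frechet_derivative (f \<circ> chart_inv (chart_at A x)) (at (snd (chart_at A x) x)) v"

definition Ck_fun ::
  "('a, 'n::finite) chart set \<Rightarrow> nat \<Rightarrow> 'a set \<Rightarrow> ('a \<Rightarrow> real) \<Rightarrow> bool" where
  "Ck_fun A k W f \<longleftrightarrow> (\<forall>c\<in>A. Ck_on k (snd c ` (fst c \<inter> W)) (f \<circ> chart_inv c))"

definition smooth_fun :: "('a, 'n::finite) chart set \<Rightarrow> 'a set \<Rightarrow> ('a \<Rightarrow> real) \<Rightarrow> bool" where
  "smooth_fun A W f \<longleftrightarrow> (\<forall>k. Ck_fun A k W f)"

definition field_in_chart ::
  "('a, 'n::finite) chart set \<Rightarrow> ('a, 'n) chart \<Rightarrow> ('a \<Rightarrow> real ^ 'n) \<Rightarrow> real ^ 'n \<Rightarrow> real ^ 'n" where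
  "field_in_chart A c V y = tdiff A (snd c) (chart_inv c y) (V (chart_inv c y))"

definition smooth_field ::
  "('a, 'n::finite) chart set \<Rightarrow> 'a set \<Rightarrow> ('a \<Rightarrow> real ^ 'n) \<Rightarrow> bool" where
  "smooth_field A W V \<longleftrightarrow> (\<forall>c\<in>A. smooth_on (snd c ` (fst c \<inter> W)) (field_in_chart A c V))"

definition smooth_field_near ::
  "('a::topological_space, 'n::finite) chart set \<Rightarrow> 'a \<Rightarrow> ('a \<Rightarrow> real ^ 'n) \<Rightarrow> bool" where
  "smooth_field_near A x V \<longleftrightarrow> (\<exists>W. open W \<and> x \<in> W \<and> smooth_field A W V)"

text \<open>A local extension of a tangent vector to a vector field. It is only used to evaluate tensorial
  expressions, whose value does not depend on the extension.\<close>

definition extension ::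
  "('a::topological_space, 'n::finite) chart set \<Rightarrow> 'a \<Rightarrow> real ^ 'n \<Rightarrow> 'a \<Rightarrow> real ^ 'n" where
  "extension A x v = (SOME V. smooth_field_near A x V \<and> V x = v)"

text \<open>The coordinate formula for \<open>[V, W]\<close>, evaluated in the very chart that identifies the tangent
  space at \<open>x\<close> with \<open>real ^ 'n\<close>.\<close>

definition lie_bracket ::
  "('a, 'n::finite) chart set \<Rightarrow> ('a \<Rightarrow> real ^ 'n) \<Rightarrow> ('a \<Rightarrow> real ^ 'n) \<Rightarrow> 'a \<Rightarrow> real ^ 'n" where
  "lie_bracket A V W x = (let c = chart_at A x; p = snd c x in
     frechet_derivative (field_in_chart A c W) (at p) (field_in_chart A c V p) -
     frechet_derivative (field_in_chart A c V) (at p) (field_in_chart A c W p))"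

section \<open>Complexified tangent vectors\<close>

definition re_vec :: "complex ^ 'n::finite \<Rightarrow> real ^ 'n" where
  "re_vec z = (\<chi> i. Re (z $ i))"

definition im_vec :: "complex ^ 'n::finite \<Rightarrow> real ^ 'n" where
  "im_vec z = (\<chi> i. Im (z $ i))"

definition complex_vec :: "real ^ 'n::finite \<Rightarrow> real ^ 'n \<Rightarrow> complex ^ 'n" where
  "complex_vec a b = (\<chi> i. Complex (a $ i) (b $ i))"

definition cnj_vec :: "complex ^ 'n::finite \<Rightarrow> complex ^ 'n" where
  "cnj_vec z = (\<chi> i. cnj (z $ i))"

text \<open>The complex bilinear extension of a real bilinear form.\<close>

definition cbilinear ::
  "(real ^ 'n::finite \<Rightarrow> real ^ 'n \<Rightarrow> real) \<Rightarrow> complex ^ 'n \<Rightarrow> complex ^ 'n \<Rightarrow> complex" where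
  "cbilinear b z w =
     Complex (b (re_vec z) (re_vec w) - b (im_vec z) (im_vec w))
             (b (re_vec z) (im_vec w) + b (im_vec z) (re_vec w))"

definition smooth_cfield ::
  "('a, 'n::finite) chart set \<Rightarrow> 'a set \<Rightarrow> ('a \<Rightarrow> complex ^ 'n) \<Rightarrow> bool" where
  "smooth_cfield A W Z \<longleftrightarrow>
     smooth_field A W (\<lambda>x. re_vec (Z x)) \<and> smooth_field A W (\<lambda>x. im_vec (Z x))"

definition clie_bracket ::
  "('a, 'n::finite) chart set \<Rightarrow> ('a \<Rightarrow> complex ^ 'n) \<Rightarrow> ('a \<Rightarrow> complex ^ 'n) \<Rightarrow> 'a \<Rightarrow> complex ^ 'n" where
  "clie_bracket A Z W x = complex_vec
     (lie_bracket A (\<lambda>y. re_vec (Z y)) (\<lambda>y. re_vec (W y)) x -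
      lie_bracket A (\<lambda>y. im_vec (Z y)) (\<lambda>y. im_vec (W y)) x)
     (lie_bracket A (\<lambda>y. re_vec (Z y)) (\<lambda>y. im_vec (W y)) x +
      lie_bracket A (\<lambda>y. im_vec (Z y)) (\<lambda>y. re_vec (W y)) x)"

section \<open>Pseudo-Hermitian manifolds\<close>

text \<open>\<open>cr_dim\<close> is the number \<open>m\<close>, \<open>T10 M x\<close> the fiber of \<open>T\<^sub>1\<^sub>,\<^sub>0M\<close> at \<open>x\<close>, and \<open>theta M x\<close> the
  1-form at \<open>x\<close>.\<close>

record ('a, 'n) ph_structure =
  atlas :: "('a, 'n) chart set"
  cr_dim :: nat
  T10 :: "'a \<Rightarrow> (complex ^ 'n) set"
  theta :: "'a \<Rightarrow> real ^ 'n \<Rightarrow> real"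

text \<open>A complex subbundle of rank \<open>cr_dim M\<close>, formally integrable and transversal to its conjugate.\<close>

definition cr_structure :: "('a::topological_space, 'n::finite) ph_structure \<Rightarrow> bool" where
  "cr_structure M \<longleftrightarrow>
     (\<forall>x. vec.subspace (T10 M x) \<and> vec.dim (T10 M x) = cr_dim M) \<and>
     (\<forall>x. \<exists>W Z. open W \<and> x \<in> W \<and> (\<forall>k<cr_dim M. smooth_cfield (atlas M) W (Z k)) \<and>
        (\<forall>y\<in>W. T10 M y = vec.span {Z k y | k. k < cr_dim M})) \<and>
     (\<forall>x. T10 M x \<inter> cnj_vec ` T10 M x = {0}) \<and>
     (\<forall>W Z Z'. open W \<longrightarrow> smooth_cfield (atlas M) W Z \<longrightarrow> smooth_cfield (atlas M) W Z' \<longrightarrow>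
        (\<forall>x\<in>W. Z x \<in> T10 M x \<and> Z' x \<in> T10 M x) \<longrightarrow>
        (\<forall>x\<in>W. clie_bracket (atlas M) Z Z' x \<in> T10 M x))"

definition levi_dist :: "('a, 'n::finite) ph_structure \<Rightarrow> 'a \<Rightarrow> (real ^ 'n) set" where
  "levi_dist M x = {v. \<exists>X\<in>T10 M x. \<exists>Y\<in>cnj_vec ` T10 M x. complex_vec v 0 = X + Y}"

text \<open>\<open>J (X + cnj X) = \<i> (X - cnj X)\<close> for \<open>X\<close> in \<open>T10\<close>; meaningful on the Levi distribution only.\<close>

definition J_levi :: "('a, 'n::finite) ph_structure \<Rightarrow> 'a \<Rightarrow> real ^ 'n \<Rightarrow> real ^ 'n" where
  "J_levi M x v = (THE w. \<exists>X\<in>T10 M x. complex_vec v 0 = X + cnj_vec X \<and>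
     complex_vec w 0 = \<i> *s (X - cnj_vec X))"

text \<open>The exterior derivative with the normalizing factor 1/2.\<close>

definition dtheta :: "('a::topological_space, 'n::finite) ph_structure \<Rightarrow> 'a \<Rightarrow> real ^ 'n \<Rightarrow> real ^ 'n \<Rightarrow> real" where
  "dtheta M x v w = (let X = extension (atlas M) x v; Y = extension (atlas M) x w in
     (tdiff (atlas M) (\<lambda>y. theta M y (Y y)) x v - tdiff (atlas M) (\<lambda>y. theta M y (X y)) x w -
      theta M x (lie_bracket (atlas M) X Y x)) / 2)"

definition levi_form :: "('a::topological_space, 'n::finite) ph_structure \<Rightarrow> 'a \<Rightarrow> real ^ 'n \<Rightarrow> real ^ 'n \<Rightarrow> real" where
  "levi_form M x v w = dtheta M x v (J_levi M x w)"

text \<open>Symmetry of the Levi form is a consequence of integrability. Hausdorffness and second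
  countability are left to the type class of \<open>'a\<close>.\<close>

definition pseudo_hermitian ::
  "('a::{t2_space, second_countable_topology}, 'n::finite) ph_structure \<Rightarrow> bool" where
  "pseudo_hermitian M \<longleftrightarrow>
     connected (UNIV :: 'a set) \<and> smooth_atlas (atlas M) \<and> orientable_atlas (atlas M) \<and>
     CARD('n) = 2 * cr_dim M + 1 \<and> cr_structure M \<and>
     (\<forall>x. linear (theta M x)) \<and>
     (\<forall>W V. open W \<longrightarrow> smooth_field (atlas M) W V \<longrightarrow> smooth_fun (atlas M) W (\<lambda>x. theta M x (V x))) \<and>
     (\<forall>x. theta M x \<noteq> (\<lambda>v. 0)) \<and>
     (\<forall>x. {v. theta M x v = 0} = levi_dist M x) \<and>
     (\<forall>x. \<forall>v\<in>levi_dist M x. v \<noteq> 0 \<longrightarrow> levi_form M x v v > 0)"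

definition reeb :: "('a::topological_space, 'n::finite) ph_structure \<Rightarrow> 'a \<Rightarrow> real ^ 'n" where
  "reeb M x = (THE v. theta M x v = 1 \<and> (\<forall>w. dtheta M x v w = 0))"

text \<open>The projection onto \<open>levi_dist M x\<close>, the kernel of \<open>theta M x\<close>, along the Reeb field.\<close>

definition proj_H :: "('a::topological_space, 'n::finite) ph_structure \<Rightarrow> 'a \<Rightarrow> real ^ 'n \<Rightarrow> real ^ 'n" where
  "proj_H M x v = v - theta M x v *\<^sub>R reeb M x"

definition J_ext :: "('a::topological_space, 'n::finite) ph_structure \<Rightarrow> 'a \<Rightarrow> real ^ 'n \<Rightarrow> real ^ 'n" where
  "J_ext M x v = J_levi M x (proj_H M x v)"

definition webster :: "('a::topological_space, 'n::finite) ph_structure \<Rightarrow> 'a \<Rightarrow> real ^ 'n \<Rightarrow> real ^ 'n \<Rightarrow> real" where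
  "webster M x v w = levi_form M x (proj_H M x v) (proj_H M x w) + theta M x v * theta M x w"

definition webster_norm :: "('a::topological_space, 'n::finite) ph_structure \<Rightarrow> 'a \<Rightarrow> real ^ 'n \<Rightarrow> real" where
  "webster_norm M x v = sqrt (webster M x v v)"

text \<open>\<open>g (X, cnj X)\<close> is real because the Webster metric is symmetric.\<close>

definition webster_cnorm :: "('a::topological_space, 'n::finite) ph_structure \<Rightarrow> 'a \<Rightarrow> complex ^ 'n \<Rightarrow> real" where
  "webster_cnorm M x X = sqrt (Re (cbilinear (webster M x) X (cnj_vec X)))"

section \<open>The Tanaka-Webster connection\<close>

text \<open>A linear connection is an operator \<open>D\<close>, where \<open>D x v Y\<close> is the covariant derivative of \<open>Y\<close> at
  \<open>x\<close> in the direction \<open>v\<close>; it only matters for fields \<open>Y\<close> that are smooth near \<open>x\<close>. Applied to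
  functions \<open>f\<close> that are 1 on a neighbourhood of \<open>x\<close> and 0 elsewhere, the Leibniz rule shows that
  \<open>D x v Y\<close> depends only on the germ of \<open>Y\<close> at \<open>x\<close>.\<close>

definition linear_connection ::
  "('a::topological_space, 'n::finite) chart set \<Rightarrow>
   ('a \<Rightarrow> real ^ 'n \<Rightarrow> ('a \<Rightarrow> real ^ 'n) \<Rightarrow> real ^ 'n) \<Rightarrow> bool" where
  "linear_connection A D \<longleftrightarrow>
     (\<forall>x Y. smooth_field_near A x Y \<longrightarrow> linear (\<lambda>v. D x v Y)) \<and>
     (\<forall>x v Y Z. smooth_field_near A x Y \<longrightarrow> smooth_field_near A x Z \<longrightarrow>
        D x v (\<lambda>y. Y y + Z y) = D x v Y + D x v Z) \<and>
     (\<forall>x v f Y. (\<exists>W. open W \<and> x \<in> W \<and> smooth_fun A W f) \<longrightarrow> smooth_field_near A x Y \<longrightarrow>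
        D x v (\<lambda>y. f y *\<^sub>R Y y) = tdiff A f x v *\<^sub>R Y x + f x *\<^sub>R D x v Y) \<and>
     (\<forall>W X Y. open W \<longrightarrow> smooth_field A W X \<longrightarrow> smooth_field A W Y \<longrightarrow>
        smooth_field A W (\<lambda>x. D x (X x) Y))"

definition torsion ::
  "('a::topological_space, 'n::finite) chart set \<Rightarrow>
   ('a \<Rightarrow> real ^ 'n \<Rightarrow> ('a \<Rightarrow> real ^ 'n) \<Rightarrow> real ^ 'n) \<Rightarrow> 'a \<Rightarrow> real ^ 'n \<Rightarrow> real ^ 'n \<Rightarrow> real ^ 'n" where
  "torsion A D x v w = (let X = extension A x v; Y = extension A x w in
     D x v Y - D x w X - lie_bracket A X Y x)"

definition tanaka_webster ::
  "('a::topological_space, 'n::finite) ph_structure \<Rightarrow>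
   ('a \<Rightarrow> real ^ 'n \<Rightarrow> ('a \<Rightarrow> real ^ 'n) \<Rightarrow> real ^ 'n) \<Rightarrow> bool" where
  "tanaka_webster M D \<longleftrightarrow> linear_connection (atlas M) D \<and>
     (\<forall>W Y. open W \<longrightarrow> smooth_field (atlas M) W Y \<longrightarrow> (\<forall>y\<in>W. Y y \<in> levi_dist M y) \<longrightarrow>
        (\<forall>x\<in>W. \<forall>v. D x v Y \<in> levi_dist M x)) \<and>
     (\<forall>x v Y. smooth_field_near (atlas M) x Y \<longrightarrow>
        D x v (\<lambda>y. J_ext M y (Y y)) = J_ext M x (D x v Y)) \<and>
     (\<forall>x v Y Z. smooth_field_near (atlas M) x Y \<longrightarrow> smooth_field_near (atlas M) x Z \<longrightarrow>
        tdiff (atlas M) (\<lambda>y. webster M y (Y y) (Z y)) x v =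
          webster M x (D x v Y) (Z x) + webster M x (Y x) (D x v Z)) \<and>
     (\<forall>x. \<forall>v\<in>levi_dist M x. \<forall>w\<in>levi_dist M x.
        torsion (atlas M) D x v w = (2 * dtheta M x v w) *\<^sub>R reeb M x) \<and>
     (\<forall>x. \<forall>v\<in>levi_dist M x.
        torsion (atlas M) D x (reeb M x) (J_ext M x v) +
        J_ext M x (torsion (atlas M) D x (reeb M x) v) = 0)"

section \<open>Gradients, Hessian and sub-Laplacian\<close>

definition gradient :: "('a::topological_space, 'n::finite) ph_structure \<Rightarrow> ('a \<Rightarrow> real) \<Rightarrow> 'a \<Rightarrow> real ^ 'n" where
  "gradient M u x = (THE w. \<forall>v. webster M x w v = tdiff (atlas M) u x v)"

definition hgradient :: "('a::topological_space, 'n::finite) ph_structure \<Rightarrow> ('a \<Rightarrow> real) \<Rightarrow> 'a \<Rightarrow> real ^ 'n" where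
  "hgradient M u x = proj_H M x (gradient M u x)"

definition hessian ::
  "('a::topological_space, 'n::finite) ph_structure \<Rightarrow>
   ('a \<Rightarrow> real ^ 'n \<Rightarrow> ('a \<Rightarrow> real ^ 'n) \<Rightarrow> real ^ 'n) \<Rightarrow> ('a \<Rightarrow> real) \<Rightarrow> 'a \<Rightarrow> real ^ 'n \<Rightarrow> real ^ 'n \<Rightarrow> real" where
  "hessian M D u x v w = (let Z = extension (atlas M) x w in
     tdiff (atlas M) (\<lambda>y. tdiff (atlas M) u y (Z y)) x v - tdiff (atlas M) u x (D x v Z))"

text \<open>Only the values at one point of a unitary frame of \<open>T10\<close> are needed; the quantities below do not
  depend on its choice.\<close>

definition unitary_frame_at ::
  "('a::topological_space, 'n::finite) ph_structure \<Rightarrow> 'a \<Rightarrow> (nat \<Rightarrow> complex ^ 'n) \<Rightarrow> bool" where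
  "unitary_frame_at M x e \<longleftrightarrow> (\<forall>k<cr_dim M. e k \<in> T10 M x) \<and>
     (\<forall>k<cr_dim M. \<forall>l<cr_dim M.
        cbilinear (webster M x) (e k) (cnj_vec (e l)) = (if k = l then 1 else 0))"

text \<open>The sum is real: the two terms for each \<open>k\<close> are complex conjugates, the Hessian of a real
  function being real.\<close>

definition sub_laplacian ::
  "('a::topological_space, 'n::finite) ph_structure \<Rightarrow>
   ('a \<Rightarrow> real ^ 'n \<Rightarrow> ('a \<Rightarrow> real ^ 'n) \<Rightarrow> real ^ 'n) \<Rightarrow> ('a \<Rightarrow> real) \<Rightarrow> 'a \<Rightarrow> real" where
  "sub_laplacian M D u x = (let e = (SOME e. unitary_frame_at M x e) in
     Re (\<Sum>k<cr_dim M. cbilinear (hessian M D u x) (e k) (cnj_vec (e k)) +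
                         cbilinear (hessian M D u x) (cnj_vec (e k)) (e k)))"

text \<open>\<open>Re \<nabla>du(X, cnj X)\<close> for \<open>X = \<Sum>k. c k *s e k\<close> in \<open>T10\<close>; the expression in brackets
  is real, being a sum of conjugate pairs.\<close>

definition re_hessian ::
  "('a::topological_space, 'n::finite) ph_structure \<Rightarrow>
   ('a \<Rightarrow> real ^ 'n \<Rightarrow> ('a \<Rightarrow> real ^ 'n) \<Rightarrow> real ^ 'n) \<Rightarrow> ('a \<Rightarrow> real) \<Rightarrow> 'a \<Rightarrow> complex ^ 'n \<Rightarrow> real" where
  "re_hessian M D u x X = (let e = (SOME e. unitary_frame_at M x e);
       c = (SOME c. X = (\<Sum>k<cr_dim M. c k *s e k));
       h = (\<lambda>k l. cbilinear (hessian M D u x) (e k) (cnj_vec (e l)) * c k * cnj (c l))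
     in Re ((\<Sum>k<cr_dim M. \<Sum>l<cr_dim M. h k l + cnj (h k l)) / 2))"

section \<open>Behaviour at infinity\<close>

definition outside_compact :: "('a::topological_space \<Rightarrow> bool) \<Rightarrow> bool" where
  "outside_compact P \<longleftrightarrow> (\<exists>K. compact K \<and> (\<forall>x. x \<notin> K \<longrightarrow> P x))"

end

theory Submission
  imports Defs
begin

text \<open>Put \<open>\<psi>(t) = \<integral>\<^sub>0\<^sup>t G(s)\<^sup>-\<^sup>1\<^sup>/\<^sup>2 ds\<close>, an increasing unbounded function, concave because \<open>G\<close> is
  nondecreasing. If \<open>u\<close> attains its supremum, the constant sequence at a maximum point works. Otherwise
  let \<open>x\<^sub>k\<close> maximize \<open>u - \<epsilon>\<^sub>k \<psi>(\<gamma>)\<close> with \<open>\<epsilon>\<^sub>k = 1 / (k + 1)\<close>; then \<open>u(x\<^sub>k)\<close> tends to \<open>sup u\<close>, so \<open>x\<^sub>k\<close> leaves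
  every compact set. At \<open>x\<^sub>k\<close> we have \<open>du = r\<^sub>k d\<gamma>\<close> with \<open>r\<^sub>k = \<epsilon>\<^sub>k \<psi>'(\<gamma>)\<close>, and concavity of \<open>\<psi>\<close> gives
  \<open>\<nabla>du \<le> r\<^sub>k \<nabla>d\<gamma>\<close> on the diagonal. The growth condition on \<open>G\<close> makes
  \<open>\<psi>'(\<gamma>) \<gamma>\<^sup>1\<^sup>/\<^sup>2 G(\<gamma>\<^sup>1\<^sup>/\<^sup>2)\<^sup>1\<^sup>/\<^sup>2\<close> bounded, and the bounds on \<open>\<gamma>\<close> then yield all conclusions.

  All tensors are evaluated only at single points, so each computation takes place in the one chart
  that identifies the tangent space there with \<open>real ^ 'n\<close>.\<close>

section \<open>Calculus of \<open>Ck_on\<close>\<close>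

text \<open>This is why an attained supremum is treated apart; it enters the general scheme with
  multiplier \<open>r = 0\<close>. At a maximizer only the ordinary second derivative test in a
  chart is needed: the connection terms of both Hessians match because du is a multiple of the
  differential of \<open>\<gamma>\<close>, and concavity of \<psi> lets the square of that
  differential be dropped. Inequalities on the diagonal suffice because, for a real bilinear form b
  and X = v + iw, the real part of b(X, conj X) is b(v,v) + b(w,w); the antisymmetric part of the
  Hessian only enters the imaginary part. Since G >= G(0) > 0, the weight that controls the Hessian
  also dominates the square root of \<open>\<gamma>\<close>, so the same estimate controls the
  gradient. The sequence is built from \<open>u\<close>, \<open>\<gamma>\<close> and
  \<open>G\<close> before any bound on derivatives of \<open>\<gamma>\<close> is used, hence one
  sequence serves all four combinations of hypotheses.\<close>

lemma frechet_derivative_within_cong: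
  assumes "\<And>y. y \<in> S \<Longrightarrow> f y = g y" "x \<in> S"
  shows "frechet_derivative f (at x within S) = frechet_derivative g (at x within S)"
proof -
  have "(f has_derivative F) (at x within S) \<longleftrightarrow> (g has_derivative F) (at x within S)" for F
    using assms has_derivative_transform[of x S] by metis
  then show ?thesis by (simp add: frechet_derivative_def)
qed

lemma Ck_on_cong:
  assumes "\<And>x. x \<in> S \<Longrightarrow> f x = g x"
  shows "Ck_on k S f \<longleftrightarrow> Ck_on k S g"
  using assms
proof (induction k arbitrary: f g)
  case 0
  then show ?case by (auto cong: continuous_on_cong)
next
  case (Suc k)
  have "f differentiable (at x within S) \<longleftrightarrow> g differentiable (at x within S)" if "x \<in> S" for x
    unfolding differentiable_def using Suc.prems that has_derivative_transform[of x S] by metis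
  moreover have "Ck_on k S (\<lambda>x. frechet_derivative f (at x within S) v) \<longleftrightarrow>
      Ck_on k S (\<lambda>x. frechet_derivative g (at x within S) v)" for v
    by (rule Suc.IH) (simp add: frechet_derivative_within_cong[OF Suc.prems])
  ultimately show ?case by simp
qed

text \<open>On an open set derivatives within the set are ordinary ones. This rule and the
  elimination rule after it trade \<open>frechet_derivative\<close> for an explicit derivative, so
  that each closure property becomes an induction on \<open>k\<close> driven by one differentiation
  rule.\<close>

lemma Ck_on_SucI:
  assumes "open S" "\<And>x. x \<in> S \<Longrightarrow> (f has_derivative f' x) (at x)" "\<And>v. Ck_on k S (\<lambda>x. f' x v)"
  shows "Ck_on (Suc k) S f"
proof -
  have "frechet_derivative f (at x within S) = f' x" if "x \<in> S" for x
    using assms(1,2) that by (simp add: at_within_open[OF that assms(1)] frechet_derivative_at[symmetric])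
  then have "Ck_on k S (\<lambda>x. frechet_derivative f (at x within S) v)" for v
    using assms(3)[of v] Ck_on_cong[of S "\<lambda>x. f' x v" "\<lambda>x. frechet_derivative f (at x within S) v"] by simp
  moreover have "f differentiable (at x within S)" if "x \<in> S" for x
    using assms(2)[OF that] has_derivative_at_withinI differentiableI by blast
  ultimately show ?thesis by simp
qed

lemma Ck_on_SucE:
  assumes "open S" "Ck_on (Suc k) S f"
  obtains f' where "\<And>x. x \<in> S \<Longrightarrow> (f has_derivative f' x) (at x)" "\<And>v. Ck_on k S (\<lambda>x. f' x v)"
proof
  show "(f has_derivative frechet_derivative f (at x within S)) (at x)" if "x \<in> S" for x
    using assms that at_within_open[OF that assms(1)] frechet_derivative_works by fastforce
  show "Ck_on k S (\<lambda>x. frechet_derivative f (at x within S) v)" for v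
    using assms by simp
qed

lemma Ck_on_lower:
  assumes "open S" "Ck_on (Suc k) S f"
  shows "Ck_on k S f"
  using assms(2)
proof (induction k arbitrary: f)
  case 0
  then show ?case
    using differentiable_imp_continuous_on[of f S] by (simp add: differentiable_on_def)
next
  case (Suc k)
  obtain f' where f': "\<And>x. x \<in> S \<Longrightarrow> (f has_derivative f' x) (at x)" "\<And>v. Ck_on (Suc k) S (\<lambda>x. f' x v)"
    using Ck_on_SucE[OF assms(1) Suc.prems] by blast
  show ?case
    using Ck_on_SucI[OF assms(1) f'(1)] Suc.IH[OF f'(2)] by blast
qed

lemma Ck_on_subset:
  assumes "open S" "open T" "T \<subseteq> S" "Ck_on k S f"
  shows "Ck_on k T f"
  using assms(4)
proof (induction k arbitrary: f)
  case 0
  then show ?case using assms continuous_on_subset by auto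
next
  case (Suc k)
  obtain f' where f': "\<And>x. x \<in> S \<Longrightarrow> (f has_derivative f' x) (at x)" "\<And>v. Ck_on k S (\<lambda>x. f' x v)"
    using Ck_on_SucE[OF assms(1) Suc.prems] by blast
  show ?case
    using Ck_on_SucI[OF assms(2), of f f'] f'(1) Suc.IH[OF f'(2)] assms(3) by blast
qed

lemma Ck_on_const: "open S \<Longrightarrow> Ck_on k S (\<lambda>x. c)"
proof (induction k arbitrary: c)
  case (Suc k)
  then show ?case by (intro Ck_on_SucI[where f' = "\<lambda>x v. 0"]) auto
qed simp

lemma Ck_on_add:
  assumes "open S" "Ck_on k S f" "Ck_on k S g"
  shows "Ck_on k S (\<lambda>x. f x + g x)"
  using assms(2,3)
proof (induction k arbitrary: f g)
  case 0
  then show ?case by (simp add: continuous_on_add)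
next
  case (Suc k)
  obtain f' where f': "\<And>x. x \<in> S \<Longrightarrow> (f has_derivative f' x) (at x)" "\<And>v. Ck_on k S (\<lambda>x. f' x v)"
    using Ck_on_SucE[OF assms(1) Suc.prems(1)] by blast
  obtain g' where g': "\<And>x. x \<in> S \<Longrightarrow> (g has_derivative g' x) (at x)" "\<And>v. Ck_on k S (\<lambda>x. g' x v)"
    using Ck_on_SucE[OF assms(1) Suc.prems(2)] by blast
  show ?case
    by (rule Ck_on_SucI[OF assms(1), where f' = "\<lambda>x v. f' x v + g' x v"])
       (auto intro!: has_derivative_add f' g' Suc.IH)
qed

lemma Ck_on_sum:
  assumes "open S" "finite I" "\<And>i. i \<in> I \<Longrightarrow> Ck_on k S (f i)"
  shows "Ck_on k S (\<lambda>x. \<Sum>i\<in>I. f i x)"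
  using assms(2,3)
  by (induction I rule: finite_induct) (auto intro!: Ck_on_const Ck_on_add assms(1))

lemma Ck_on_scaleR:
  fixes f :: "'e::real_normed_vector \<Rightarrow> real" and g :: "'e \<Rightarrow> 'b::real_normed_vector"
  assumes "open S" "Ck_on k S f" "Ck_on k S g"
  shows "Ck_on k S (\<lambda>x. f x *\<^sub>R g x)"
  using assms(2,3)
proof (induction k arbitrary: f g)
  case 0
  then show ?case by (simp add: continuous_on_scaleR)
next
  case (Suc k)
  obtain f' where f': "\<And>x. x \<in> S \<Longrightarrow> (f has_derivative f' x) (at x)" "\<And>v. Ck_on k S (\<lambda>x. f' x v)"
    using Ck_on_SucE[OF assms(1) Suc.prems(1)] by blast
  obtain g' where g': "\<And>x. x \<in> S \<Longrightarrow> (g has_derivative g' x) (at x)" "\<And>v. Ck_on k S (\<lambda>x. g' x v)"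
    using Ck_on_SucE[OF assms(1) Suc.prems(2)] by blast
  show ?case
    by (rule Ck_on_SucI[OF assms(1), where f' = "\<lambda>x v. f x *\<^sub>R g' x v + f' x v *\<^sub>R g x"])
       (auto intro!: has_derivative_scaleR f' g' Suc.IH Ck_on_add assms(1)
         Ck_on_lower[OF assms(1) Suc.prems(1)] Ck_on_lower[OF assms(1) Suc.prems(2)])
qed

lemma Ck_on_bounded_linear:
  assumes "open S" "bounded_linear L" "Ck_on k S f"
  shows "Ck_on k S (\<lambda>x. L (f x))"
  using assms(3)
proof (induction k arbitrary: f)
  case 0
  then show ?case using assms(2) by (simp add: bounded_linear.continuous_on)
next
  case (Suc k)
  obtain f' where f': "\<And>x. x \<in> S \<Longrightarrow> (f has_derivative f' x) (at x)" "\<And>v. Ck_on k S (\<lambda>x. f' x v)"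
    using Ck_on_SucE[OF assms(1) Suc.prems] by blast
  show ?case
    by (rule Ck_on_SucI[OF assms(1), where f' = "\<lambda>x v. L (f' x v)"])
       (auto intro!: bounded_linear.has_derivative[OF assms(2)] f' Suc.IH)
qed

lemma linear_sum_Basis:
  fixes L :: "'a::euclidean_space \<Rightarrow> 'b::real_vector"
  assumes "linear L"
  shows "L v = (\<Sum>b\<in>Basis. (v \<bullet> b) *\<^sub>R L b)"
proof -
  have "L v = L (\<Sum>b\<in>Basis. (v \<bullet> b) *\<^sub>R b)" by (simp add: euclidean_representation)
  then show ?thesis using assms by (simp add: linear_sum linear_scale)
qed

text \<open>The recursion controls the derivative of \<open>g\<close> only in fixed directions,
  whereas the chain rule evaluates it in the moving direction \<open>f' x v\<close>. Expanding that
  direction in an orthonormal basis turns the derivative into a sum of products of functions known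
  to be of class \<open>k\<close>; hence the Euclidean intermediate space.\<close>

lemma Ck_on_compose:
  fixes f :: "'e::real_normed_vector \<Rightarrow> 'f::euclidean_space" and g :: "'f \<Rightarrow> 'b::real_normed_vector"
  assumes "open S" "open T" "f ` S \<subseteq> T" "Ck_on k S f" "Ck_on k T g"
  shows "Ck_on k S (g \<circ> f)"
  using assms(4,5)
proof (induction k arbitrary: g)
  case 0
  then show ?case using assms(3) by (simp add: continuous_on_compose continuous_on_subset del: o_apply)
next
  case (Suc k)
  obtain f' where f': "\<And>x. x \<in> S \<Longrightarrow> (f has_derivative f' x) (at x)" "\<And>v. Ck_on k S (\<lambda>x. f' x v)"
    using Ck_on_SucE[OF assms(1) Suc.prems(1)] by blast
  obtain g' where g': "\<And>x. x \<in> T \<Longrightarrow> (g has_derivative g' x) (at x)" "\<And>v. Ck_on k T (\<lambda>x. g' x v)"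
    using Ck_on_SucE[OF assms(2) Suc.prems(2)] by blast
  have fk: "Ck_on k S f" by (rule Ck_on_lower[OF assms(1) Suc.prems(1)])
  show ?case
  proof (rule Ck_on_SucI[OF assms(1), where f' = "\<lambda>x v. \<Sum>b\<in>Basis. (f' x v \<bullet> b) *\<^sub>R g' (f x) b"])
    fix x assume x: "x \<in> S"
    have "f x \<in> T" using assms(3) x by blast
    then have "(\<lambda>v. g' (f x) (f' x v)) = (\<lambda>v. \<Sum>b\<in>Basis. (f' x v \<bullet> b) *\<^sub>R g' (f x) b)"
      using linear_sum_Basis[OF has_derivative_linear[OF g'(1)]] by blast
    then show "((g \<circ> f) has_derivative (\<lambda>v. \<Sum>b\<in>Basis. (f' x v \<bullet> b) *\<^sub>R g' (f x) b)) (at x)"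
      using has_derivative_compose[OF f'(1)[OF x] g'(1)[OF \<open>f x \<in> T\<close>]] by (simp add: o_def)
  next
    fix v
    have "Ck_on k S (\<lambda>x. g' (f x) b)" for b
      using Suc.IH[OF fk g'(2)[of b]] by (simp add: o_def)
    then show "Ck_on k S (\<lambda>x. \<Sum>b\<in>Basis. (f' x v \<bullet> b) *\<^sub>R g' (f x) b)"
      by (intro Ck_on_sum Ck_on_scaleR Ck_on_bounded_linear[OF _ bounded_linear_inner_left] assms(1) f'(2)) auto
  qed
qed

section \<open>Calculus in a chart\<close>

lemma chart_at:
  assumes "smooth_atlas A"
  shows "chart_at A x \<in> A" "x \<in> fst (chart_at A x)"
proof -
  have "x \<in> (\<Union>c\<in>A. fst c)" using assms by (simp add: smooth_atlas_def)
  then obtain c where "c \<in> A \<and> x \<in> fst c" by blast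
  then have "chart_at A x \<in> A \<and> x \<in> fst (chart_at A x)"
    unfolding chart_at_def by (rule someI)
  then show "chart_at A x \<in> A" "x \<in> fst (chart_at A x)" by auto
qed

lemma atlas_chart:
  assumes "smooth_atlas A" "c \<in> A"
  shows "open (fst c)" "open (snd c ` fst c)" "continuous_on (fst c) (snd c)"
    "continuous_on (snd c ` fst c) (chart_inv c)"
    "\<And>y. y \<in> fst c \<Longrightarrow> chart_inv c (snd c y) = y"
  using assms by (auto simp: smooth_atlas_def is_chart_def homeomorphism_def)

lemma open_chart_image:
  assumes "smooth_atlas A" "c \<in> A" "open W"
  shows "open (snd c ` (fst c \<inter> W))"
proof -
  have "snd c ` (fst c \<inter> W) = snd c ` fst c \<inter> chart_inv c -` W"
    using atlas_chart(5)[OF assms(1,2)] by force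
  then show ?thesis
    using continuous_open_preimage[OF atlas_chart(4,2)[OF assms(1,2)] assms(3)] by simp
qed

lemma transition_smooth:
  assumes "smooth_atlas A" "c \<in> A" "d \<in> A"
  shows "Ck_on k (snd c ` (fst c \<inter> fst d)) (snd d \<circ> chart_inv c)"
  using assms by (auto simp: smooth_atlas_def smooth_on_def)

lemma eventually_chart:
  assumes "smooth_atlas A" "c \<in> A" "open W" "y \<in> fst c" "y \<in> W"
  shows "eventually (\<lambda>q. \<exists>z\<in>fst c \<inter> W. q = snd c z) (nhds (snd c y))"
  using eventually_nhds_in_open[OF open_chart_image[OF assms(1-3)], of "snd c y"] assms(4,5)
  by (auto elim: eventually_mono)

text \<open>The inverse of \<open>tdiff A (snd c) y\<close>, which passes from the components in \<open>c\<close> to the tangent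
  space at \<open>y\<close>.\<close>

definition chart_push :: "('a, 'n::finite) chart set \<Rightarrow> ('a, 'n) chart \<Rightarrow> 'a \<Rightarrow> real ^ 'n \<Rightarrow> real ^ 'n" where
  "chart_push A c y = frechet_derivative (snd (chart_at A y) \<circ> chart_inv c) (at (snd c y))"

lemma transition_has_derivative:
  assumes "smooth_atlas A" "c \<in> A" "d \<in> A" "y \<in> fst c" "y \<in> fst d"
  shows "((snd d \<circ> chart_inv c) has_derivative
    frechet_derivative (snd d \<circ> chart_inv c) (at (snd c y))) (at (snd c y))"
proof -
  have op: "open (snd c ` (fst c \<inter> fst d))"
    using open_chart_image[OF assms(1,2) atlas_chart(1)[OF assms(1,3)]] .
  have "snd c y \<in> snd c ` (fst c \<inter> fst d)" using assms by auto
  then show ?thesis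
    using Ck_on_SucE[OF op transition_smooth[OF assms(1-3)]] frechet_derivative_at by metis
qed

lemma tdiff_chart_derivative:
  assumes "smooth_atlas A" "c \<in> A" "y \<in> fst c"
  shows "((snd c \<circ> chart_inv (chart_at A y)) has_derivative tdiff A (snd c) y) (at (snd (chart_at A y) y))"
  using transition_has_derivative[OF assms(1) chart_at(1)[OF assms(1)] assms(2) chart_at(2)[OF assms(1)] assms(3)]
  unfolding tdiff_def[abs_def] .

lemma linear_tdiff_chart: "smooth_atlas A \<Longrightarrow> c \<in> A \<Longrightarrow> y \<in> fst c \<Longrightarrow> linear (tdiff A (snd c) y)"
  using tdiff_chart_derivative has_derivative_linear by blast

text \<open>Factor \<open>f\<close> in the chart at \<open>y\<close> through the transition map to
  \<open>c\<close>. A differential defined through an arbitrarily chosen chart can thereby be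
  computed in any chart around the point.\<close>

lemma tdiff_chain:
  assumes "smooth_atlas A" "c \<in> A" "y \<in> fst c"
    and "((f \<circ> chart_inv c) has_derivative f') (at (snd c y))"
  shows "tdiff A f y v = f' (tdiff A (snd c) y v)"
proof -
  define e where "e = chart_at A y"
  have e: "e \<in> A" "y \<in> fst e" using chart_at[OF assms(1)] by (auto simp: e_def)
  have "((\<lambda>q. (f \<circ> chart_inv c) ((snd c \<circ> chart_inv e) q)) has_derivative
      (\<lambda>v. f' (tdiff A (snd c) y v))) (at (snd e y))"
    by (rule has_derivative_compose[OF tdiff_chart_derivative[OF assms(1-3), folded e_def]])
       (use assms(4) atlas_chart(5)[OF assms(1) e(1) e(2)] in \<open>simp add: o_def\<close>)
  moreover have "eventually (\<lambda>q. (f \<circ> chart_inv c) ((snd c \<circ> chart_inv e) q) = (f \<circ> chart_inv e) q) (nhds (snd e y))"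
    using eventually_chart[OF assms(1) e(1) atlas_chart(1)[OF assms(1,2)] e(2) assms(3)]
    by eventually_elim (auto simp: atlas_chart(5)[OF assms(1,2)] atlas_chart(5)[OF assms(1) e(1)])
  ultimately have "((f \<circ> chart_inv e) has_derivative (\<lambda>v. f' (tdiff A (snd c) y v))) (at (snd e y))"
    using has_derivative_transform_eventually eventually_at_filter
    by (smt (verit) UNIV_I eventually_mono eventually_nhds_x_imp_x)
  then show ?thesis
    unfolding tdiff_def[of A f] e_def[symmetric] by (simp add: frechet_derivative_at[symmetric])
qed

lemma tdiff_chart_at:
  assumes "smooth_atlas A"
  shows "tdiff A (snd (chart_at A y)) y v = v"
proof -
  define e where "e = chart_at A y"
  have e: "e \<in> A" "y \<in> fst e" using chart_at[OF assms(1)] by (auto simp: e_def)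
  have "eventually (\<lambda>q. q = (snd e \<circ> chart_inv e) q) (nhds (snd e y))"
    using eventually_chart[OF assms(1) e(1) open_UNIV e(2)]
    by (auto elim!: eventually_mono simp: atlas_chart(5)[OF assms(1) e(1)])
  then have "((snd e \<circ> chart_inv e) has_derivative (\<lambda>v. v)) (at (snd e y))"
    using has_derivative_transform_eventually[OF has_derivative_ident] eventually_at_filter
    by (smt (verit) UNIV_I eventually_mono eventually_nhds_x_imp_x)
  then show ?thesis
    unfolding tdiff_def e_def[symmetric] by (simp add: frechet_derivative_at[symmetric])
qed

lemma chart_push:
  assumes "smooth_atlas A" "c \<in> A" "y \<in> fst c"
  shows "chart_push A c y (tdiff A (snd c) y v) = v" "tdiff A (snd c) y (chart_push A c y v) = v"
    "linear (chart_push A c y)"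
proof -
  have d: "((snd (chart_at A y) \<circ> chart_inv c) has_derivative chart_push A c y) (at (snd c y))"
    unfolding chart_push_def
    using transition_has_derivative[OF assms(1,2) chart_at(1) assms(3) chart_at(2)] assms(1) by blast
  show lin: "linear (chart_push A c y)" using d has_derivative_linear by blast
  have *: "chart_push A c y (tdiff A (snd c) y v) = v" for v
    using tdiff_chain[OF assms d, of v] tdiff_chart_at[OF assms(1)] by simp
  then show "chart_push A c y (tdiff A (snd c) y v) = v" .
  \<comment> \<open>A one-sided inverse between spaces of equal finite dimension is two-sided, so
    the other composition needs no second chain rule.\<close>
  have "chart_push A c y \<circ> tdiff A (snd c) y = id" using * by auto
  then have "tdiff A (snd c) y \<circ> chart_push A c y = id"
    using linear_inverse_left[OF linear_tdiff_chart[OF assms] lin] by simp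
  then show "tdiff A (snd c) y (chart_push A c y v) = v" by (metis comp_apply id_apply)
qed

text \<open>The field with prescribed components \<open>F\<close> in \<open>c\<close>; a constant
  \<open>F\<close> gives the coordinate fields. The value 0 off the chart domain is a mere
  default.\<close>

definition chart_field ::
  "('a, 'n::finite) chart set \<Rightarrow> ('a, 'n) chart \<Rightarrow> (real ^ 'n \<Rightarrow> real ^ 'n) \<Rightarrow> 'a \<Rightarrow> real ^ 'n" where
  "chart_field A c F y = (if y \<in> fst c then chart_push A c y (F (snd c y)) else 0)"

lemma field_in_chart_image:
  assumes "smooth_atlas A" "c \<in> A" "y \<in> fst c"
  shows "field_in_chart A c V (snd c y) = tdiff A (snd c) y (V y)"
  by (simp add: field_in_chart_def atlas_chart(5)[OF assms])

lemma chart_field_at: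
  assumes "smooth_atlas A"
  shows "chart_field A (chart_at A x) F x = F (snd (chart_at A x) x)"
  using chart_push(1)[OF assms chart_at[OF assms], of x] tdiff_chart_at[OF assms] chart_at[OF assms]
  by (simp add: chart_field_def)

text \<open>In another chart \<open>d\<close> the components are the Jacobian of the transition map
  applied to \<open>F\<close>, read off after returning from \<open>d\<close> to \<open>c\<close>.
  This is the function \<open>h\<close> below composed with a transition map, and the Jacobian is of
  class \<open>k\<close> because the transition map is of class \<open>Suc k\<close>.\<close>

lemma smooth_chart_field:
  assumes "smooth_atlas A" "c \<in> A" "open W" "W \<subseteq> fst c" "smooth_on (snd c ` W) F"
  shows "smooth_field A W (chart_field A c F)"
  unfolding smooth_field_def smooth_on_def
proof (intro ballI allI)
  fix d k assume d: "d \<in> A"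
  let ?S = "snd d ` (fst d \<inter> W)" and ?T = "snd c ` (fst c \<inter> (fst d \<inter> W))" and ?\<tau> = "snd d \<circ> chart_inv c"
  have opS: "open ?S" using open_chart_image[OF assms(1) d assms(3)] .
  have opT: "open ?T" using open_chart_image[OF assms(1,2)] atlas_chart(1)[OF assms(1) d] assms(3) by blast
  have opc: "open (snd c ` (fst c \<inter> fst d))"
    using open_chart_image[OF assms(1,2)] atlas_chart(1)[OF assms(1) d] by blast
  have opd: "open (snd d ` (fst d \<inter> fst c))"
    using open_chart_image[OF assms(1) d] atlas_chart(1)[OF assms(1,2)] by blast
  have opW: "open (snd c ` W)" using open_chart_image[OF assms(1-3)] assms(4) by (simp add: Int_absorb1)
  define \<tau>' where "\<tau>' p = frechet_derivative ?\<tau> (at p)" for p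
  define h where "h p = (\<Sum>b\<in>Basis. (F p \<bullet> b) *\<^sub>R \<tau>' p b)" for p
  have "Ck_on k ?T (\<lambda>p. \<tau>' p b)" for b
  proof -
    obtain t where t: "\<And>x. x \<in> snd c ` (fst c \<inter> fst d) \<Longrightarrow> (?\<tau> has_derivative t x) (at x)"
        "\<And>v. Ck_on k (snd c ` (fst c \<inter> fst d)) (\<lambda>x. t x v)"
      using Ck_on_SucE[OF opc transition_smooth[OF assms(1,2) d]] by blast
    have "\<tau>' p = t p" if "p \<in> ?T" for p
    proof -
      have "p \<in> snd c ` (fst c \<inter> fst d)" using that by blast
      then show ?thesis unfolding \<tau>'_def using t(1) frechet_derivative_at by metis
    qed
    moreover have "Ck_on k ?T (\<lambda>x. t x b)" using Ck_on_subset[OF opc opT _ t(2)] by blast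
    ultimately show ?thesis using Ck_on_cong[of ?T "\<lambda>p. \<tau>' p b" "\<lambda>x. t x b"] by simp
  qed
  moreover have "Ck_on k ?T F"
    using Ck_on_subset[OF opW opT] assms(5) by (auto simp: smooth_on_def)
  ultimately have h: "Ck_on k ?T h"
    unfolding h_def
    by (intro Ck_on_sum Ck_on_scaleR Ck_on_bounded_linear[OF _ bounded_linear_inner_left] opT) auto
  have "Ck_on k ?S (snd c \<circ> chart_inv d)"
    using Ck_on_subset[OF opd opS _ transition_smooth[OF assms(1) d assms(2)]] assms(4) by blast
  moreover have "(snd c \<circ> chart_inv d) ` ?S \<subseteq> ?T"
    using atlas_chart(5)[OF assms(1) d] assms(4) by auto
  ultimately have "Ck_on k ?S (h \<circ> (snd c \<circ> chart_inv d))"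
    using Ck_on_compose[OF opS opT _ _ h] by blast
  moreover have "field_in_chart A d (chart_field A c F) q = (h \<circ> (snd c \<circ> chart_inv d)) q" if q: "q \<in> ?S" for q
  proof -
    obtain y where y: "y \<in> fst d" "y \<in> W" "q = snd d y" using q by blast
    have yc: "y \<in> fst c" using y(2) assms(4) by blast
    have der: "(?\<tau> has_derivative \<tau>' (snd c y)) (at (snd c y))"
      unfolding \<tau>'_def by (rule transition_has_derivative[OF assms(1,2) d yc y(1)])
    have "field_in_chart A d (chart_field A c F) q = tdiff A (snd d) y (chart_field A c F y)"
      unfolding y(3) by (rule field_in_chart_image[OF assms(1) d y(1)])
    also have "\<dots> = \<tau>' (snd c y) (F (snd c y))"
      using tdiff_chain[OF assms(1,2) yc der] yc chart_push(2)[OF assms(1,2) yc] by (simp add: chart_field_def)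
    also have "\<dots> = h (snd c y)"
      unfolding h_def by (rule linear_sum_Basis[OF has_derivative_linear[OF der]])
    finally show ?thesis using atlas_chart(5)[OF assms(1) d y(1)] y(3) by simp
  qed
  ultimately show "Ck_on k ?S (field_in_chart A d (chart_field A c F))"
    using Ck_on_cong[of ?S "field_in_chart A d (chart_field A c F)" "h \<circ> (snd c \<circ> chart_inv d)"] by blast
qed

lemma has_derivative_transform_nhds:
  assumes "eventually (\<lambda>q. f q = g q) (nhds p)" "(f has_derivative F) (at p)"
  shows "(g has_derivative F) (at p)"
proof -
  have "eventually (\<lambda>q. f q = g q) (at p)"
    using assms(1) by (auto simp: eventually_at_filter elim: eventually_mono)
  moreover have "f p = g p" using eventually_nhds_x_imp_x[OF assms(1)] .
  ultimately show ?thesis using has_derivative_transform_eventually[OF assms(2)] by blast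
qed

section \<open>Smooth vector fields: restriction, components and extensions\<close>

lemma smooth_field_subset:
  assumes "smooth_atlas A" "open W" "open W'" "W' \<subseteq> W" "smooth_field A W V"
  shows "smooth_field A W' V"
  unfolding smooth_field_def smooth_on_def
proof (intro ballI allI)
  fix c k assume c: "c \<in> A"
  have "Ck_on k (snd c ` (fst c \<inter> W)) (field_in_chart A c V)"
    using assms(5) c by (auto simp: smooth_field_def smooth_on_def)
  then show "Ck_on k (snd c ` (fst c \<inter> W')) (field_in_chart A c V)"
    using Ck_on_subset[OF open_chart_image[OF assms(1) c assms(2)] open_chart_image[OF assms(1) c assms(3)]]
      assms(4) by blast
qed

lemma smooth_field_cong:
  assumes "smooth_atlas A" "\<And>y. y \<in> W \<Longrightarrow> V y = V' y" "smooth_field A W V"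
  shows "smooth_field A W V'"
  unfolding smooth_field_def smooth_on_def
proof (intro ballI allI)
  fix c k assume c: "c \<in> A"
  have "Ck_on k (snd c ` (fst c \<inter> W)) (field_in_chart A c V)"
    using assms(3) c by (auto simp: smooth_field_def smooth_on_def)
  moreover have "field_in_chart A c V q = field_in_chart A c V' q" if "q \<in> snd c ` (fst c \<inter> W)" for q
    using that assms(2) by (auto simp: field_in_chart_image[OF assms(1) c])
  ultimately show "Ck_on k (snd c ` (fst c \<inter> W)) (field_in_chart A c V')"
    using Ck_on_cong by blast
qed

lemma smooth_field_near_chart:
  assumes "smooth_atlas A" "c \<in> A" "x \<in> fst c" "smooth_field_near A x V"
  obtains W where "open W" "x \<in> W" "W \<subseteq> fst c" "smooth_field A W V"
    "smooth_on (snd c ` W) (field_in_chart A c V)"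
proof -
  obtain W where W: "open W" "x \<in> W" "smooth_field A W V"
    using assms(4) by (auto simp: smooth_field_near_def)
  have "smooth_field A (W \<inter> fst c) V"
    by (rule smooth_field_subset[OF assms(1) W(1) _ _ W(3)]) (use W atlas_chart(1)[OF assms(1,2)] in auto)
  moreover from this have "smooth_on (snd c ` (fst c \<inter> (W \<inter> fst c))) (field_in_chart A c V)"
    using assms(2) unfolding smooth_field_def by blast
  then have "smooth_on (snd c ` (W \<inter> fst c)) (field_in_chart A c V)"
    by (simp add: Int_left_commute Int_absorb Int_commute)
  ultimately show ?thesis
    using that[of "W \<inter> fst c"] W assms(3) atlas_chart(1)[OF assms(1,2)] by auto
qed

lemma smooth_on_has_derivative:
  assumes "smooth_on S f" "open S" "p \<in> S"
  obtains F where "(f has_derivative F) (at p)"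
  using assms Ck_on_SucE[of S 0 f] unfolding smooth_on_def by metis

lemma field_has_derivative:
  assumes "smooth_atlas A" "c \<in> A" "x \<in> fst c" "smooth_field_near A x V"
  obtains V' where "(field_in_chart A c V has_derivative V') (at (snd c x))"
proof -
  obtain W where W: "open W" "x \<in> W" "W \<subseteq> fst c" "smooth_on (snd c ` W) (field_in_chart A c V)"
    using smooth_field_near_chart[OF assms] by metis
  have "open (snd c ` W)"
    using open_chart_image[OF assms(1,2) W(1)] W(3) by (simp add: Int_absorb1)
  then show ?thesis using smooth_on_has_derivative[OF W(4)] W(2) that by blast
qed

lemma field_in_chart_at:
  assumes "smooth_atlas A"
  shows "field_in_chart A (chart_at A x) V (snd (chart_at A x) x) = V x"
  using field_in_chart_image[OF assms chart_at[OF assms]] tdiff_chart_at[OF assms] by simp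

lemma chart_field_field_in_chart:
  assumes "smooth_atlas A" "c \<in> A" "y \<in> fst c"
  shows "chart_field A c (field_in_chart A c V) y = V y"
  using assms field_in_chart_image[OF assms] chart_push(1)[OF assms] by (simp add: chart_field_def)

lemma smooth_chart_field_const:
  assumes "smooth_atlas A" "c \<in> A"
  shows "smooth_field A (fst c) (chart_field A c (\<lambda>q. v))"
  by (rule smooth_chart_field[OF assms atlas_chart(1)[OF assms]])
     (auto simp: smooth_on_def intro: Ck_on_const atlas_chart(2)[OF assms])

text \<open>The field with constant components in the chart at \<open>x\<close> is a witness for the
  choice made in \<open>extension\<close>.\<close>

lemma extension:
  assumes "smooth_atlas A"
  shows "smooth_field_near A x (extension A x v)" "extension A x v x = v"
proof -
  let ?V = "chart_field A (chart_at A x) (\<lambda>q. v)"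
  have "smooth_field_near A x ?V \<and> ?V x = v"
    using smooth_chart_field_const[OF assms chart_at(1)[OF assms]] chart_at(2)[OF assms]
      atlas_chart(1)[OF assms chart_at(1)[OF assms]] chart_field_at[OF assms]
    unfolding smooth_field_near_def by metis
  then have "smooth_field_near A x (extension A x v) \<and> extension A x v x = v"
    unfolding extension_def by (rule someI[of "\<lambda>V. smooth_field_near A x V \<and> V x = v"])
  then show "smooth_field_near A x (extension A x v)" "extension A x v x = v" by auto
qed

lemma linear_inner_sum:
  fixes f :: "'a::euclidean_space \<Rightarrow> 'b::real_vector"
  shows "linear (\<lambda>w::'a. \<Sum>b\<in>Basis. (w \<bullet> b) *\<^sub>R f b)"
  by (rule linearI) (simp_all add: inner_add_left scaleR_add_left sum.distrib scaleR_sum_right)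

abbreviation coord_field :: "('a, 'n::finite) chart set \<Rightarrow> 'a \<Rightarrow> real ^ 'n \<Rightarrow> 'a \<Rightarrow> real ^ 'n" where
  "coord_field A x b \<equiv> chart_field A (chart_at A x) (\<lambda>q. b)"

text \<open>\<open>\<omega>\<close> is a 1-form and \<open>\<omega>' b\<close> is the differential of the
  \<open>b\<close>-component of \<open>\<omega>\<close> in the chart at \<open>x\<close>.\<close>

lemma tdiff_form_field:
  assumes "smooth_atlas A" and c: "c = chart_at A x"
    and lin: "\<And>y. y \<in> fst c \<Longrightarrow> linear (\<omega> y)"
    and \<omega>': "\<And>b. b \<in> Basis \<Longrightarrow>
      ((\<lambda>q. \<omega> (chart_inv c q) (coord_field A x b (chart_inv c q))) has_derivative \<omega>' b) (at (snd c x))"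
    and V': "(field_in_chart A c V has_derivative V') (at (snd c x))"
  shows "tdiff A (\<lambda>y. \<omega> y (V y)) x v = \<omega> x (V' v) + (\<Sum>b\<in>Basis. (V x \<bullet> b) * \<omega>' b v)"
proof -
  note cA = chart_at[OF assms(1), of x, folded c]
  let ?\<omega> = "\<lambda>b q. \<omega> (chart_inv c q) (coord_field A x b (chart_inv c q))"
  \<comment> \<open>This is the product rule for the pairing expanded in the coordinate fields; in
    the chart at \<open>x\<close> these take the values \<open>b\<close> at \<open>x\<close>
    itself.\<close>
  have der: "((\<lambda>q. \<Sum>b\<in>Basis. (field_in_chart A c V q \<bullet> b) * ?\<omega> b q) has_derivative
      (\<lambda>v. \<Sum>b\<in>Basis. (field_in_chart A c V (snd c x) \<bullet> b) * \<omega>' b v + (V' v \<bullet> b) * ?\<omega> b (snd c x))) (at (snd c x))"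
    by (intro has_derivative_sum has_derivative_mult \<omega>' has_derivative_inner_left V')
  have "(\<Sum>b\<in>Basis. (field_in_chart A c V (snd c x) \<bullet> b) * \<omega>' b v + (V' v \<bullet> b) * ?\<omega> b (snd c x)) =
      \<omega> x (V' v) + (\<Sum>b\<in>Basis. (V x \<bullet> b) * \<omega>' b v)" for v
    using linear_sum_Basis[OF lin[OF cA(2)], of "V' v"] field_in_chart_at[OF assms(1), of x V, folded c]
      chart_field_at[OF assms(1), of x] atlas_chart(5)[OF assms(1) cA]
    by (simp add: sum.distrib)
  then have "((\<lambda>q. \<Sum>b\<in>Basis. (field_in_chart A c V q \<bullet> b) * ?\<omega> b q) has_derivative
      (\<lambda>v. \<omega> x (V' v) + (\<Sum>b\<in>Basis. (V x \<bullet> b) * \<omega>' b v))) (at (snd c x))"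
    by (intro has_derivative_eq_rhs[OF der] ext)
  moreover have "\<omega> y (V y) = (\<Sum>b\<in>Basis. (field_in_chart A c V (snd c y) \<bullet> b) * ?\<omega> b (snd c y))"
    if y: "y \<in> fst c" for y
  proof -
    note cy = assms(1) cA(1) y
    have "V y = (\<Sum>b\<in>Basis. (field_in_chart A c V (snd c y) \<bullet> b) *\<^sub>R chart_push A c y b)"
      using chart_field_field_in_chart[OF cy, of V] y linear_sum_Basis[OF chart_push(3)[OF cy], of "field_in_chart A c V (snd c y)"]
      by (simp add: chart_field_def)
    then have "\<omega> y (V y) = (\<Sum>b\<in>Basis. (field_in_chart A c V (snd c y) \<bullet> b) * \<omega> y (chart_push A c y b))"
      using lin[OF y] by (simp add: linear_sum linear_scale)
    then show ?thesis using y atlas_chart(5)[OF cy] by (simp add: chart_field_def c[symmetric])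
  qed
  then have ev: "eventually (\<lambda>q. (\<Sum>b\<in>Basis. (field_in_chart A c V q \<bullet> b) * ?\<omega> b q) =
      ((\<lambda>y. \<omega> y (V y)) \<circ> chart_inv c) q) (nhds (snd c x))"
    using eventually_chart[OF assms(1) cA(1) open_UNIV cA(2) UNIV_I]
    by (auto elim!: eventually_mono simp: atlas_chart(5)[OF assms(1) cA(1)])
  ultimately have "(((\<lambda>y. \<omega> y (V y)) \<circ> chart_inv c) has_derivative
      (\<lambda>v. \<omega> x (V' v) + (\<Sum>b\<in>Basis. (V x \<bullet> b) * \<omega>' b v))) (at (snd c x))"
    by (intro has_derivative_transform_nhds[OF ev])
  from tdiff_chain[OF assms(1) cA this] show ?thesis
    by (simp add: c tdiff_chart_at[OF assms(1)])
qed

section \<open>Connections and Hessians in a chart\<close>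

lemma connection_add:
  "linear_connection A D \<Longrightarrow> smooth_field_near A x Y \<Longrightarrow> smooth_field_near A x Z \<Longrightarrow>
    D x v (\<lambda>y. Y y + Z y) = D x v Y + D x v Z"
  by (simp add: linear_connection_def)

lemma connection_scaleR:
  "linear_connection A D \<Longrightarrow> open W \<Longrightarrow> x \<in> W \<Longrightarrow> smooth_fun A W f \<Longrightarrow> smooth_field_near A x Y \<Longrightarrow>
    D x v (\<lambda>y. f y *\<^sub>R Y y) = tdiff A f x v *\<^sub>R Y x + f x *\<^sub>R D x v Y"
  unfolding linear_connection_def by blast

text \<open>Intended for indicators of open sets: constancy near \<open>x\<close> is all the
  smoothness that the Leibniz rule at \<open>x\<close> asks for.\<close>

lemma locally_const:
  assumes "smooth_atlas A" "open W" "x \<in> W" "\<And>y. y \<in> W \<Longrightarrow> f y = (r::real)"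
  shows "smooth_fun A W f" "tdiff A f x v = 0"
proof -
  show "smooth_fun A W f"
    unfolding smooth_fun_def Ck_fun_def
  proof (intro allI ballI)
    fix k c assume c: "c \<in> A"
    have "(f \<circ> chart_inv c) q = r" if "q \<in> snd c ` (fst c \<inter> W)" for q
      using that assms(4) atlas_chart(5)[OF assms(1) c] by auto
    then show "Ck_on k (snd c ` (fst c \<inter> W)) (f \<circ> chart_inv c)"
      using Ck_on_cong[of "snd c ` (fst c \<inter> W)" "f \<circ> chart_inv c" "\<lambda>q. r" k]
        Ck_on_const[OF open_chart_image[OF assms(1) c assms(2)]] by blast
  qed
  note c = chart_at[OF assms(1), of x]
  have "eventually (\<lambda>q. r = (f \<circ> chart_inv (chart_at A x)) q) (nhds (snd (chart_at A x) x))"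
    using eventually_chart[OF assms(1) c(1) assms(2) c(2) assms(3)]
    by (auto elim!: eventually_mono simp: atlas_chart(5)[OF assms(1) c(1)] assms(4))
  then have "((f \<circ> chart_inv (chart_at A x)) has_derivative (\<lambda>v. 0)) (at (snd (chart_at A x) x))"
    by (rule has_derivative_transform_nhds[OF _ has_derivative_const])
  then show "tdiff A f x v = 0" using tdiff_chain[OF assms(1) c] by blast
qed

lemma connection_local:
  assumes "smooth_atlas A" "linear_connection A D" "open W" "x \<in> W"
    "\<And>y. y \<in> W \<Longrightarrow> Y y = Z y" "smooth_field_near A x Y"
  shows "D x v Y = D x v Z"
proof -
  obtain W' where W': "open W'" "x \<in> W'" "smooth_field A W' Y"
    using assms(6) by (auto simp: smooth_field_near_def)
  have "smooth_field A (W \<inter> W') Y"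
    using smooth_field_subset[OF assms(1) W'(1) _ _ W'(3)] assms(3) W'(1) by blast
  then have "smooth_field A (W \<inter> W') Z"
    using smooth_field_cong[OF assms(1)] assms(5) by blast
  then have Z: "smooth_field_near A x Z"
    unfolding smooth_field_near_def using W' assms(3,4) by blast
  \<comment> \<open>Multiplying by the indicator makes \<open>Y\<close> and \<open>Z\<close> equal
    as global functions, while value 1 and differential 0 at \<open>x\<close> leave both covariant
    derivatives there unchanged.\<close>
  define f :: "'a \<Rightarrow> real" where "f = indicator W"
  have f: "smooth_fun A W f" "tdiff A f x v = 0"
    using locally_const[OF assms(1,3,4), of f 1] by (auto simp: f_def)
  have fx: "f x = 1" using assms(4) by (simp add: f_def)
  have "(\<lambda>y. f y *\<^sub>R Y y) = (\<lambda>y. f y *\<^sub>R Z y)"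
  proof
    show "f y *\<^sub>R Y y = f y *\<^sub>R Z y" for y
      using assms(5)[of y] by (cases "y \<in> W") (simp_all add: f_def)
  qed
  then show ?thesis
    using connection_scaleR[OF assms(2,3,4) f(1) assms(6), of v] connection_scaleR[OF assms(2,3,4) f(1) Z, of v]
    by (simp add: f(2) fx)
qed

text \<open>The usual formula "derivative of the components plus Christoffel terms": near
  \<open>x\<close> the field is a combination of coordinate fields, to which additivity and the
  Leibniz rule apply. The expansion holds only near \<open>x\<close>, so locality of the connection
  is used at the end. Additivity concerns two summands, hence the induction over sets of basis
  vectors.\<close>

lemma connection_chart:
  assumes "smooth_atlas A" "linear_connection A D" and c: "c = chart_at A x"
    and Z: "smooth_field_near A x Z" and Z': "(field_in_chart A c Z has_derivative Z') (at (snd c x))"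
  shows "D x v Z = Z' v + (\<Sum>b\<in>Basis. (Z x \<bullet> b) *\<^sub>R D x v (coord_field A x b))"
proof -
  note cA = chart_at[OF assms(1), of x, folded c]
  define F where "F = field_in_chart A c Z"
  obtain W where W: "open W" "x \<in> W" "W \<subseteq> fst c" "smooth_on (snd c ` W) F"
    using smooth_field_near_chart[OF assms(1) cA Z] F_def by metis
  have opW: "open (snd c ` W)"
    using open_chart_image[OF assms(1) cA(1) W(1)] W(3) by (simp add: Int_absorb1)
  have sm: "smooth_field_near A x (chart_field A c (\<lambda>q. \<Sum>b\<in>S. (F q \<bullet> b) *\<^sub>R b))" if "finite S" for S
    unfolding smooth_field_near_def
  proof (intro exI conjI)
    show "smooth_field A W (chart_field A c (\<lambda>q. \<Sum>b\<in>S. (F q \<bullet> b) *\<^sub>R b))"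
      by (rule smooth_chart_field[OF assms(1) cA(1) W(1,3)], unfold smooth_on_def,
          intro allI Ck_on_sum Ck_on_scaleR Ck_on_bounded_linear[OF _ bounded_linear_inner_left] Ck_on_const opW that)
         (use W(4) in \<open>auto simp: smooth_on_def\<close>)
  qed (use W in auto)
  have smE: "smooth_field_near A x (coord_field A x b)" for b
    unfolding smooth_field_near_def c[symmetric]
    using smooth_chart_field_const[OF assms(1) cA(1)] cA(2) atlas_chart(1)[OF assms(1) cA(1)] by blast
  have f: "smooth_fun A W (\<lambda>y. F (snd c y) \<bullet> b)" for b
    unfolding smooth_fun_def Ck_fun_def
  proof (intro allI ballI)
    fix k d assume d: "d \<in> A"
    let ?S = "snd d ` (fst d \<inter> W)"
    have opS: "open ?S" by (rule open_chart_image[OF assms(1) d W(1)])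
    have opd: "open (snd d ` (fst d \<inter> fst c))"
      using open_chart_image[OF assms(1) d] atlas_chart(1)[OF assms(1) cA(1)] by blast
    have tr: "Ck_on k ?S (snd c \<circ> chart_inv d)"
      using Ck_on_subset[OF opd opS _ transition_smooth[OF assms(1) d cA(1)]] W(3) by blast
    have im: "(snd c \<circ> chart_inv d) ` ?S \<subseteq> snd c ` W"
      using atlas_chart(5)[OF assms(1) d] by auto
    have "Ck_on k (snd c ` W) (\<lambda>q. F q \<bullet> b)"
      using Ck_on_bounded_linear[OF opW bounded_linear_inner_left] W(4) by (auto simp: smooth_on_def)
    from Ck_on_compose[OF opS opW im tr this]
    show "Ck_on k ?S ((\<lambda>y. F (snd c y) \<bullet> b) \<circ> chart_inv d)" by (simp add: o_def)
  qed
  have tf: "tdiff A (\<lambda>y. F (snd c y) \<bullet> b) x v = Z' v \<bullet> b" for b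
  proof -
    have "eventually (\<lambda>q. F q \<bullet> b = ((\<lambda>y. F (snd c y) \<bullet> b) \<circ> chart_inv c) q) (nhds (snd c x))"
      using eventually_chart[OF assms(1) cA(1) open_UNIV cA(2) UNIV_I]
      by (auto elim!: eventually_mono simp: atlas_chart(5)[OF assms(1) cA(1)])
    moreover have "((\<lambda>q. F q \<bullet> b) has_derivative (\<lambda>v. Z' v \<bullet> b)) (at (snd c x))"
      using has_derivative_inner_left[OF Z'] by (simp add: F_def)
    ultimately have "(((\<lambda>y. F (snd c y) \<bullet> b) \<circ> chart_inv c) has_derivative (\<lambda>v. Z' v \<bullet> b)) (at (snd c x))"
      by (rule has_derivative_transform_nhds)
    from tdiff_chain[OF assms(1) cA this] show ?thesis by (simp add: c tdiff_chart_at[OF assms(1)])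
  qed
  have Fx: "F (snd c x) = Z x" unfolding F_def c by (rule field_in_chart_at[OF assms(1)])
  have part: "D x v (chart_field A c (\<lambda>q. \<Sum>b\<in>S. (F q \<bullet> b) *\<^sub>R b)) =
      (\<Sum>b\<in>S. (Z' v \<bullet> b) *\<^sub>R b + (Z x \<bullet> b) *\<^sub>R D x v (coord_field A x b))" if "finite S" for S
    using that
  proof (induction S rule: finite_induct)
    case empty
    \<comment> \<open>The empty sum is the zero field. Writing it as the zero function times a
      smooth field lets the Leibniz rule show that its covariant derivative vanishes.\<close>
    have "D x v (\<lambda>y. 0 *\<^sub>R coord_field A x 0 y) = 0"
      using connection_scaleR[OF assms(2) open_UNIV UNIV_I _ smE[of 0], of "\<lambda>y. 0" v]
        locally_const(1)[OF assms(1) open_UNIV UNIV_I, of "\<lambda>y. 0" 0]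
        locally_const(2)[OF assms(1) open_UNIV UNIV_I, of "\<lambda>y. 0" 0 x v] by simp
    moreover have "chart_field A c (\<lambda>q. \<Sum>b\<in>{}. (F q \<bullet> b) *\<^sub>R b) = (\<lambda>y. 0 *\<^sub>R coord_field A x 0 y)"
      using chart_push(3)[OF assms(1) cA(1)] by (auto simp: chart_field_def linear_0)
    ultimately show ?case by simp
  next
    case (insert b S)
    let ?R = "chart_field A c (\<lambda>q. \<Sum>b\<in>S. (F q \<bullet> b) *\<^sub>R b)"
    have 1: "chart_field A c (\<lambda>q. (F q \<bullet> b) *\<^sub>R b) = (\<lambda>y. (F (snd c y) \<bullet> b) *\<^sub>R coord_field A x b y)"
      using chart_push(3)[OF assms(1) cA(1)] by (auto simp: chart_field_def linear_scale c)
    have 2: "chart_field A c (\<lambda>q. \<Sum>b\<in>insert b S. (F q \<bullet> b) *\<^sub>R b) =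
        (\<lambda>y. chart_field A c (\<lambda>q. (F q \<bullet> b) *\<^sub>R b) y + ?R y)"
      using chart_push(3)[OF assms(1) cA(1)] insert.hyps by (auto simp: chart_field_def linear_add)
    have "D x v (\<lambda>y. chart_field A c (\<lambda>q. (F q \<bullet> b) *\<^sub>R b) y + ?R y) =
        D x v (chart_field A c (\<lambda>q. (F q \<bullet> b) *\<^sub>R b)) + D x v ?R"
      using connection_add[OF assms(2) _ sm] sm[of "{b}"] insert.hyps by simp
    moreover have "D x v (chart_field A c (\<lambda>q. (F q \<bullet> b) *\<^sub>R b)) =
        (Z' v \<bullet> b) *\<^sub>R b + (Z x \<bullet> b) *\<^sub>R D x v (coord_field A x b)"
      unfolding 1 connection_scaleR[OF assms(2) W(1,2) f smE] tf Fx
      by (simp add: chart_field_at[OF assms(1)])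
    ultimately show ?case
      unfolding 2 unfolding sum.insert[OF insert.hyps] insert.IH by simp
  qed
  have "D x v Z = D x v (chart_field A c (\<lambda>q. \<Sum>b\<in>Basis. (F q \<bullet> b) *\<^sub>R b))"
  proof (rule connection_local[OF assms(1,2) W(1,2) _ Z])
    show "Z y = chart_field A c (\<lambda>q. \<Sum>b\<in>Basis. (F q \<bullet> b) *\<^sub>R b) y" if "y \<in> W" for y
      using chart_field_field_in_chart[OF assms(1) cA(1), of y Z] that W(3)
      by (auto simp: euclidean_representation F_def)
  qed
  then show ?thesis
    using part[OF finite_Basis] by (simp add: sum.distrib euclidean_representation)
qed

text \<open>The order of the indices matters later: \<open>U'' v q\<close> differentiates, at
  \<open>q\<close>, the directional derivative already taken along \<open>v\<close>.\<close>

lemma C2_chart: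
  assumes "smooth_atlas A" "c \<in> A" "Ck_fun A 2 UNIV u"
  obtains U' U'' where "\<And>q. q \<in> snd c ` fst c \<Longrightarrow> ((u \<circ> chart_inv c) has_derivative U' q) (at q)"
    "\<And>q v. q \<in> snd c ` fst c \<Longrightarrow> ((\<lambda>q. U' q v) has_derivative U'' v q) (at q)"
proof -
  note op = atlas_chart(2)[OF assms(1,2)]
  have "Ck_on (Suc (Suc 0)) (snd c ` fst c) (u \<circ> chart_inv c)"
    using assms(2,3) by (auto simp: Ck_fun_def numeral_2_eq_2 simp del: Ck_on.simps)
  then obtain U' where U': "\<And>q. q \<in> snd c ` fst c \<Longrightarrow> ((u \<circ> chart_inv c) has_derivative U' q) (at q)"
    "\<And>v. Ck_on (Suc 0) (snd c ` fst c) (\<lambda>q. U' q v)"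
    using Ck_on_SucE[OF op] by blast
  show ?thesis
  proof (rule that[of U' "\<lambda>v q. frechet_derivative (\<lambda>q. U' q v) (at q)"])
    fix q v assume q: "q \<in> snd c ` fst c"
    show "((u \<circ> chart_inv c) has_derivative U' q) (at q)" by (rule U'(1)[OF q])
    show "((\<lambda>q. U' q v) has_derivative frechet_derivative (\<lambda>q. U' q v) (at q)) (at q)"
      using Ck_on_SucE[OF op U'(2)[of v]] q differentiableI frechet_derivative_works by metis
  qed
qed

lemma linear_tdiff:
  assumes "smooth_atlas A" "c \<in> A" "y \<in> fst c" "((u \<circ> chart_inv c) has_derivative U') (at (snd c y))"
  shows "linear (tdiff A u y)"
proof -
  have eq: "tdiff A u y = U' \<circ> tdiff A (snd c) y" using tdiff_chain[OF assms] by (intro ext) simp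
  show ?thesis
    unfolding eq by (rule linear_compose[OF linear_tdiff_chart[OF assms(1-3)] has_derivative_linear[OF assms(4)]])
qed

lemma C2_linear_tdiff:
  assumes "smooth_atlas A" "Ck_fun A 2 UNIV u"
  shows "linear (tdiff A u x)"
proof -
  note c = chart_at[OF assms(1), of x]
  obtain U' where "((u \<circ> chart_inv (chart_at A x)) has_derivative U') (at (snd (chart_at A x) x))"
    using C2_chart[OF assms(1) c(1) assms(2)] c(2) by (metis imageI)
  then show ?thesis by (rule linear_tdiff[OF assms(1) c])
qed

lemma C2_continuous:
  fixes u :: "'a::t2_space \<Rightarrow> real"
  assumes "smooth_atlas A" "Ck_fun A 2 UNIV u"
  shows "continuous_on UNIV u"
  unfolding continuous_on_eq_continuous_at[OF open_UNIV]
proof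
  fix x
  define c where "c = chart_at A x"
  note cA = chart_at[OF assms(1), of x, folded c_def]
  obtain U' where "((u \<circ> chart_inv c) has_derivative U') (at (snd c x))"
    using C2_chart[OF assms(1) cA(1) assms(2)] cA(2) by (metis imageI)
  then have "isCont (u \<circ> chart_inv c) (snd c x)" using has_derivative_continuous by blast
  moreover have "isCont (snd c) x"
    using atlas_chart(1,3)[OF assms(1) cA(1)] cA(2) continuous_on_eq_continuous_at by blast
  ultimately have "isCont (\<lambda>y. (u \<circ> chart_inv c) (snd c y)) x"
    using isCont_o2[of x "snd c" "u \<circ> chart_inv c"] by blast
  moreover have ev: "eventually (\<lambda>y. (u \<circ> chart_inv c) (snd c y) = u y) (nhds x)"
    using eventually_nhds_in_open[OF atlas_chart(1)[OF assms(1) cA(1)] cA(2)]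
    by (auto elim!: eventually_mono simp: atlas_chart(5)[OF assms(1) cA(1)])
  ultimately show "isCont u x" using isCont_cong[OF ev] by blast
qed

text \<open>The Christoffel symbols at \<open>x\<close> in the chart chosen there, contracted with
  the direction \<open>v\<close> and the field value \<open>w\<close>.\<close>

definition conn_coeff ::
  "('a, 'n::finite) chart set \<Rightarrow> ('a \<Rightarrow> real ^ 'n \<Rightarrow> ('a \<Rightarrow> real ^ 'n) \<Rightarrow> real ^ 'n) \<Rightarrow> 'a \<Rightarrow>
    real ^ 'n \<Rightarrow> real ^ 'n \<Rightarrow> real ^ 'n" where
  "conn_coeff A D x v w = (\<Sum>b\<in>Basis. (w \<bullet> b) *\<^sub>R D x v (coord_field A x b))"

lemma bilinear_conn_coeff:
  assumes "smooth_atlas A" "linear_connection A D"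
  shows "bilinear (conn_coeff A D x)"
  unfolding bilinear_def
proof (intro conjI allI)
  show "linear (conn_coeff A D x v)" for v
    unfolding conn_coeff_def[abs_def] by (rule linear_inner_sum)
  have "smooth_field_near A x (coord_field A x b)" for b
    unfolding smooth_field_near_def
    using smooth_chart_field_const[OF assms(1) chart_at(1)[OF assms(1)]] chart_at(2)[OF assms(1)]
      atlas_chart(1)[OF assms(1) chart_at(1)[OF assms(1)]] by blast
  then have "linear (\<lambda>v. D x v (coord_field A x b))" for b
    using assms(2) by (simp add: linear_connection_def)
  then show "linear (\<lambda>v. conn_coeff A D x v w)" for w
    unfolding conn_coeff_def by (intro linear_compose_sum linear_compose_scale_right ballI) simp
qed

text \<open>The derivative \<open>Z'\<close> of the components of the extension occurs once in the
  derivative of \<open>Zu\<close> and once in the covariant derivative of \<open>Z\<close>, and the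
  two cancel. What remains depends on \<open>v\<close> and \<open>w\<close> only, whichever
  extension was chosen.\<close>

lemma hessian_chart:
  assumes "smooth_atlas (atlas M)" "linear_connection (atlas M) D" and c: "c = chart_at (atlas M) x"
    and U': "\<And>q. q \<in> snd c ` fst c \<Longrightarrow> ((u \<circ> chart_inv c) has_derivative U' q) (at q)"
    and U'': "\<And>v. ((\<lambda>q. U' q v) has_derivative U'' v) (at (snd c x))"
  shows "hessian M D u x v w = U'' w v - U' (snd c x) (conn_coeff (atlas M) D x v w)"
proof -
  note cA = chart_at[OF assms(1), of x, folded c]
  define Z where "Z = extension (atlas M) x w"
  note Z = extension[OF assms(1), of x w, folded Z_def]
  obtain Z' where Z': "(field_in_chart (atlas M) c Z has_derivative Z') (at (snd c x))"
    using field_has_derivative[OF assms(1) cA Z(1)] .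
  have td: "tdiff (atlas M) u y v = U' (snd c y) (tdiff (atlas M) (snd c) y v)" if "y \<in> fst c" for y v
    using tdiff_chain[OF assms(1) cA(1) that] U' that by blast
  have U'lin: "linear (U' q)" if "q \<in> snd c ` fst c" for q using U'[OF that] has_derivative_linear by blast
  have lin: "linear (tdiff (atlas M) u y)" if "y \<in> fst c" for y
    using linear_tdiff[OF assms(1) cA(1) that] U' that by blast
  note tdx = tdiff_chart_at[OF assms(1), of x, folded c]
  have ev: "eventually (\<lambda>q. q \<in> snd c ` fst c) (nhds (snd c x))"
    using eventually_nhds_in_open[OF atlas_chart(2)[OF assms(1) cA(1)]] cA(2) by blast
  have comp: "((\<lambda>q. tdiff (atlas M) u (chart_inv c q) (coord_field (atlas M) x b (chart_inv c q)))
      has_derivative U'' b) (at (snd c x))" for b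
  proof (rule has_derivative_transform_nhds[OF _ U''])
    show "\<forall>\<^sub>F q in nhds (snd c x). U' q b =
        tdiff (atlas M) u (chart_inv c q) (coord_field (atlas M) x b (chart_inv c q))"
      using ev by eventually_elim
        (auto simp: atlas_chart(5)[OF assms(1) cA(1)] td chart_field_def c[symmetric]
          chart_push(2)[OF assms(1) cA(1)])
  qed
  have "tdiff (atlas M) (\<lambda>y. tdiff (atlas M) u y (Z y)) x v =
      tdiff (atlas M) u x (Z' v) + (\<Sum>b\<in>Basis. (w \<bullet> b) * U'' b v)"
    using tdiff_form_field[where \<omega> = "tdiff (atlas M) u" and \<omega>' = U'', OF assms(1) c lin comp Z', of v] Z(2) by simp
  moreover have "D x v Z = Z' v + conn_coeff (atlas M) D x v w"
    using connection_chart[OF assms(1,2) c Z(1) Z'] Z(2) by (simp add: conn_coeff_def)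
  \<comment> \<open>For each direction separately, \<open>U''\<close> is just the derivative of a
    function. Its linearity in that direction comes from differentiating the linearity of
    \<open>U' q\<close> and uniqueness of derivatives.\<close>
  moreover have "U'' w v = (\<Sum>b\<in>Basis. (w \<bullet> b) * U'' b v)"
  proof -
    have "((\<lambda>q. \<Sum>b\<in>Basis. (w \<bullet> b) * U' q b) has_derivative (\<lambda>v. \<Sum>b\<in>Basis. (w \<bullet> b) * U'' b v)) (at (snd c x))"
      by (intro has_derivative_sum has_derivative_mult_right U'')
    moreover have "eventually (\<lambda>q. (\<Sum>b\<in>Basis. (w \<bullet> b) * U' q b) = U' q w) (nhds (snd c x))"
      using ev by eventually_elim (simp add: linear_sum_Basis[OF U'lin, of _ w])
    ultimately have "((\<lambda>q. U' q w) has_derivative (\<lambda>v. \<Sum>b\<in>Basis. (w \<bullet> b) * U'' b v)) (at (snd c x))"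
      by (intro has_derivative_transform_nhds[of _ "\<lambda>q. U' q w"])
    from has_derivative_unique[OF U'' this] show ?thesis by metis
  qed
  moreover have "linear (U' (snd c x))" using U'lin cA(2) by blast
  ultimately show ?thesis
    unfolding hessian_def Let_def Z_def[symmetric]
    by (simp add: td[OF cA(2)] tdx linear_add)
qed

lemma bilinear_hessian:
  assumes "smooth_atlas (atlas M)" "linear_connection (atlas M) D" "Ck_fun (atlas M) 2 UNIV u"
  shows "bilinear (hessian M D u x)"
proof -
  define c where "c = chart_at (atlas M) x"
  note cA = chart_at[OF assms(1), of x, folded c_def]
  obtain U' U'' where U: "\<And>q. q \<in> snd c ` fst c \<Longrightarrow> ((u \<circ> chart_inv c) has_derivative U' q) (at q)"
    "\<And>q v. q \<in> snd c ` fst c \<Longrightarrow> ((\<lambda>q. U' q v) has_derivative U'' v q) (at q)"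
    using C2_chart[OF assms(1) cA(1) assms(3)] by blast
  have p: "snd c x \<in> snd c ` fst c" using cA by blast
  have h: "hessian M D u x v w = U'' w (snd c x) v - U' (snd c x) (conn_coeff (atlas M) D x v w)" for v w
    by (rule hessian_chart[OF assms(1,2) c_def U(1) U(2)[OF p]])
  have ev: "eventually (\<lambda>q. q \<in> snd c ` fst c) (nhds (snd c x))"
    using eventually_nhds_in_open[OF atlas_chart(2)[OF assms(1) cA(1)] p] .
  have U'lin: "linear (U' q)" if "q \<in> snd c ` fst c" for q using U(1)[OF that] has_derivative_linear by blast
  have lin2: "linear (\<lambda>w. U'' w (snd c x) v)" for v
  proof (rule linearI)
    fix w w' and r :: real
    have "((\<lambda>q. U' q w + U' q w') has_derivative (\<lambda>v. U'' w (snd c x) v + U'' w' (snd c x) v)) (at (snd c x))"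
      by (intro has_derivative_add U(2) p)
    then have "((\<lambda>q. U' q (w + w')) has_derivative (\<lambda>v. U'' w (snd c x) v + U'' w' (snd c x) v)) (at (snd c x))"
      by (rule has_derivative_transform_nhds[rotated])
         (use ev in eventually_elim, simp add: linear_add[OF U'lin])
    then show "U'' (w + w') (snd c x) v = U'' w (snd c x) v + U'' w' (snd c x) v"
      using has_derivative_unique[OF U(2)[OF p]] by metis
    have "((\<lambda>q. r *\<^sub>R U' q w) has_derivative (\<lambda>v. r *\<^sub>R U'' w (snd c x) v)) (at (snd c x))"
      by (intro has_derivative_scaleR_right U(2) p)
    then have "((\<lambda>q. U' q (r *\<^sub>R w)) has_derivative (\<lambda>v. r *\<^sub>R U'' w (snd c x) v)) (at (snd c x))"
      by (rule has_derivative_transform_nhds[rotated])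
         (use ev in eventually_elim, simp add: linear_scale[OF U'lin])
    then show "U'' (r *\<^sub>R w) (snd c x) v = r *\<^sub>R U'' w (snd c x) v"
      using has_derivative_unique[OF U(2)[OF p]] by metis
  qed
  have lin1: "linear (U'' w (snd c x))" for w using U(2)[OF p] has_derivative_linear by blast
  note conn = bilinear_conn_coeff[OF assms(1,2), of x]
  show ?thesis
    unfolding bilinear_def
  proof (intro conjI allI)
    fix v
    have "linear (conn_coeff (atlas M) D x v)" "linear (\<lambda>w. conn_coeff (atlas M) D x w v)"
      using conn by (auto simp: bilinear_def)
    from this[THEN linear_compose[OF _ U'lin[OF p]]]
    have l: "linear (\<lambda>w. U' (snd c x) (conn_coeff (atlas M) D x v w))"
      "linear (\<lambda>w. U' (snd c x) (conn_coeff (atlas M) D x w v))" by (simp_all add: o_def)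
    show "linear (hessian M D u x v)"
      using linear_compose_sub[OF lin2 l(1)] by (simp add: h[abs_def])
    show "linear (\<lambda>w. hessian M D u x w v)"
      using linear_compose_sub[OF lin1 l(2)] by (simp add: h)
  qed
qed

section \<open>Comparison at a maximum point\<close>

text \<open>Along the line through \<open>p\<close> in direction \<open>v\<close>, a positive second
  derivative would make the first derivative positive just after 0, and the mean value theorem would
  then produce a value larger than the maximum. Only differentiability of the directional derivative
  at the single point \<open>p\<close> is used, not continuity of second derivatives.\<close>

lemma second_derivative_nonpos:
  fixes \<Phi> :: "'e::real_normed_vector \<Rightarrow> real"
  assumes "open S" "p \<in> S" and max: "\<And>q. q \<in> S \<Longrightarrow> \<Phi> q \<le> \<Phi> p"
    and d: "\<And>q. q \<in> S \<Longrightarrow> (\<Phi> has_derivative \<Phi>' q) (at q)"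
    and dd: "((\<lambda>q. \<Phi>' q v) has_derivative \<Phi>'') (at p)"
  shows "\<Phi>' p w = 0" "\<Phi>'' v \<le> 0"
proof -
  have "\<Phi>' p = (\<lambda>v. 0)"
    by (rule differential_zero_maxmin[OF assms(2,1) d[OF assms(2)]]) (use max in simp)
  then have zero: "\<Phi>' p w = 0" for w by simp
  then show "\<Phi>' p w = 0" .
  show "\<Phi>'' v \<le> 0"
  proof (rule ccontr)
    assume pos: "\<not> \<Phi>'' v \<le> 0"
    have line: "((\<lambda>t. p + t *\<^sub>R v) has_derivative (\<lambda>t. t *\<^sub>R v)) (at t)" for t :: real
      by (auto intro!: derivative_eq_intros)
    have "((\<lambda>t. \<Phi>' (p + t *\<^sub>R v) v) has_derivative (\<lambda>t. \<Phi>'' (t *\<^sub>R v))) (at 0)"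
      using has_derivative_compose[OF line, of "\<lambda>q. \<Phi>' q v" \<Phi>'' 0] dd by simp
    then have "((\<lambda>t. \<Phi>' (p + t *\<^sub>R v) v) has_real_derivative \<Phi>'' v) (at 0)"
      by (rule has_derivative_imp_has_field_derivative) (simp add: linear_scale[OF has_derivative_linear[OF dd]])
    then obtain e where e: "e > 0" "\<And>h. 0 < h \<Longrightarrow> h < e \<Longrightarrow> 0 < \<Phi>' (p + h *\<^sub>R v) v"
      using DERIV_pos_inc_right[of "\<lambda>t. \<Phi>' (p + t *\<^sub>R v) v" "\<Phi>'' v" 0] pos by (auto simp: zero)
    have "isCont (\<lambda>t::real. p + t *\<^sub>R v) 0" by (intro continuous_intros)
    then have "eventually (\<lambda>t. p + t *\<^sub>R v \<in> S) (nhds 0)"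
      using assms(1,2) by (simp add: continuous_at_open eventually_nhds)
    then obtain r where r: "r > 0" "\<And>t. \<bar>t\<bar> < r \<Longrightarrow> p + t *\<^sub>R v \<in> S"
      by (auto simp: eventually_nhds_metric dist_real_def)
    \<comment> \<open>Halving keeps \<open>h\<close> strictly below both radii: the whole segment up
      to \<open>h\<close> lies in \<open>S\<close>, and the slope is positive at every interior
      point of it.\<close>
    define h where "h = min e r / 2"
    have h: "0 < h" "h < e" "h < r" using e(1) r(1) by (auto simp: h_def)
    have "\<exists>z>0. z < h \<and> \<Phi> (p + h *\<^sub>R v) - \<Phi> (p + 0 *\<^sub>R v) = (h - 0) * \<Phi>' (p + z *\<^sub>R v) v"
    proof (rule MVT2[OF h(1)])
      fix t :: real assume t: "0 \<le> t" "t \<le> h"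
      then have S: "p + t *\<^sub>R v \<in> S" using r(2) h by auto
      show "((\<lambda>t. \<Phi> (p + t *\<^sub>R v)) has_real_derivative \<Phi>' (p + t *\<^sub>R v) v) (at t)"
        by (rule has_derivative_imp_has_field_derivative[OF has_derivative_compose[OF line d[OF S]]])
          (simp add: linear_scale[OF has_derivative_linear[OF d[OF S]]])
    qed
    then obtain z where z: "0 < z" "z < h" "\<Phi> (p + h *\<^sub>R v) - \<Phi> p = h * \<Phi>' (p + z *\<^sub>R v) v" by auto
    have "0 < h * \<Phi>' (p + z *\<^sub>R v) v" using e(2)[of z] z h by simp
    moreover have "\<Phi> (p + h *\<^sub>R v) \<le> \<Phi> p" using max r(2)[of h] h by simp
    ultimately show False using z(3) by simp
  qed
qed

text \<open>The second derivative test for \<open>u - \<psi> \<circ> \<gamma>\<close> bounds the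
  second derivative of \<open>u\<close> by \<open>g (\<gamma> x)\<close> times that of
  \<open>\<gamma>\<close> plus \<open>g'\<close> times a square, which is nonpositive. The
  first-order condition makes the Christoffel terms proportional with the same factor, so the
  inequality passes to the Hessians. The set \<open>I\<close> allows a \<open>\<psi>\<close> that is
  differentiable only for positive arguments.\<close>

lemma hessian_comparison:
  fixes M :: "('a::t2_space, 'n::finite) ph_structure"
  assumes "smooth_atlas (atlas M)" "linear_connection (atlas M) D"
    and "Ck_fun (atlas M) 2 UNIV u" "Ck_fun (atlas M) 2 UNIV \<gamma>"
    and I: "open I" "\<gamma> x \<in> I" and g: "\<And>t. t \<in> I \<Longrightarrow> (\<psi> has_real_derivative g t) (at t)"
    and g': "(g has_real_derivative g') (at (\<gamma> x))" "g' \<le> 0"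
    and max: "\<And>y. u y - \<psi> (\<gamma> y) \<le> u x - \<psi> (\<gamma> x)"
  shows "tdiff (atlas M) u x v = g (\<gamma> x) * tdiff (atlas M) \<gamma> x v"
    and "hessian M D u x v v \<le> g (\<gamma> x) * hessian M D \<gamma> x v v"
proof -
  define c where "c = chart_at (atlas M) x"
  define p where "p = snd c x"
  note cA = chart_at[OF assms(1), of x, folded c_def]
  have inv: "chart_inv c p = x" unfolding p_def by (rule atlas_chart(5)[OF assms(1) cA])
  obtain U' U'' where U: "\<And>q. q \<in> snd c ` fst c \<Longrightarrow> ((u \<circ> chart_inv c) has_derivative U' q) (at q)"
    "\<And>q v. q \<in> snd c ` fst c \<Longrightarrow> ((\<lambda>q. U' q v) has_derivative U'' v q) (at q)"
    using C2_chart[OF assms(1) cA(1) assms(3)] by blast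
  obtain C' C'' where C: "\<And>q. q \<in> snd c ` fst c \<Longrightarrow> ((\<gamma> \<circ> chart_inv c) has_derivative C' q) (at q)"
    "\<And>q v. q \<in> snd c ` fst c \<Longrightarrow> ((\<lambda>q. C' q v) has_derivative C'' v q) (at q)"
    using C2_chart[OF assms(1) cA(1) assms(4)] by blast
  have p: "p \<in> snd c ` fst c" using cA by (simp add: p_def)
  \<comment> \<open>Restricting the chart to points whose \<open>\<gamma>\<close>-value lies in
    \<open>I\<close> makes the chain rule for \<open>\<psi>\<close> available at every point of
    \<open>S\<close>.\<close>
  define S where "S = snd c ` (fst c \<inter> \<gamma> -` I)"
  have "open (\<gamma> -` I)" using C2_continuous[OF assms(1,4)] I(1) by (simp add: continuous_on_open_vimage)
  then have S: "open S" unfolding S_def by (rule open_chart_image[OF assms(1) cA(1)])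
  have pS: "p \<in> S" using cA(2) I(2) by (auto simp: S_def p_def)
  let ?\<Phi> = "\<lambda>q. (u \<circ> chart_inv c) q - \<psi> ((\<gamma> \<circ> chart_inv c) q)"
  let ?\<Phi>' = "\<lambda>q v. U' q v - g ((\<gamma> \<circ> chart_inv c) q) * C' q v"
  let ?\<Phi>'' = "\<lambda>w. U'' v p w - (g (\<gamma> x) * C'' v p w + g' * C' p w * C' p v)"
  have d1: "(?\<Phi> has_derivative ?\<Phi>' q) (at q)" if "q \<in> S" for q
  proof -
    have q: "q \<in> snd c ` fst c" "(\<gamma> \<circ> chart_inv c) q \<in> I"
      using that atlas_chart(5)[OF assms(1) cA(1)] by (auto simp: S_def)
    show ?thesis
      using has_derivative_diff[OF U(1)[OF q(1)]
        has_derivative_compose[OF C(1)[OF q(1)] g[OF q(2), unfolded has_field_derivative_def]]]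
      by simp
  qed
  have d2: "((\<lambda>q. ?\<Phi>' q v) has_derivative ?\<Phi>'') (at p)"
  proof -
    have "((\<lambda>q. g ((\<gamma> \<circ> chart_inv c) q)) has_derivative (\<lambda>w. g' * C' p w)) (at p)"
      using has_derivative_compose[OF C(1)[OF p], of g "(*) g'"] g'(1) by (simp add: inv has_field_derivative_def)
    from has_derivative_diff[OF U(2)[OF p, of v] has_derivative_mult[OF this C(2)[OF p, of v]]]
    show ?thesis by (simp add: inv)
  qed
  have mx: "?\<Phi> q \<le> ?\<Phi> p" if "q \<in> S" for q using max by (simp add: inv)
  note test = second_derivative_nonpos[OF S pS mx d1 d2]
  have td: "tdiff (atlas M) u x w = U' p w" "tdiff (atlas M) \<gamma> x w = C' p w" for w
    using tdiff_chain[OF assms(1) cA U(1)[OF p, unfolded p_def]]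
      tdiff_chain[OF assms(1) cA C(1)[OF p, unfolded p_def]] tdiff_chart_at[OF assms(1), of x, folded c_def]
    by (simp_all add: p_def)
  have 1: "tdiff (atlas M) u x v = g (\<gamma> x) * tdiff (atlas M) \<gamma> x v" for v
    using test(1)[of v] by (simp add: td inv)
  then show "tdiff (atlas M) u x v = g (\<gamma> x) * tdiff (atlas M) \<gamma> x v" .
  have "g' * C' p v * C' p v \<le> 0"
    using g'(2) by (simp add: mult.assoc mult_nonpos_nonneg)
  then have "U'' v p v \<le> g (\<gamma> x) * C'' v p v" using test(2) by simp
  moreover have "hessian M D u x v v = U'' v p v - U' p (conn_coeff (atlas M) D x v v)"
    unfolding p_def by (rule hessian_chart[OF assms(1,2) c_def U(1) U(2)[OF p[unfolded p_def]]])
  moreover have "hessian M D \<gamma> x v v = C'' v p v - C' p (conn_coeff (atlas M) D x v v)"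
    unfolding p_def by (rule hessian_chart[OF assms(1,2) c_def C(1) C(2)[OF p[unfolded p_def]]])
  ultimately show "hessian M D u x v v \<le> g (\<gamma> x) * hessian M D \<gamma> x v v"
    using 1[unfolded td] by (simp add: right_diff_distrib)
qed

section \<open>The Webster metric\<close>

lemma bilinear_linear: "bilinear f \<Longrightarrow> linear (f v)" "bilinear f \<Longrightarrow> linear (\<lambda>v. f v w)"
  by (simp_all add: bilinear_def)

text \<open>Nondegeneracy makes \<open>v \<mapsto> f v\<close> injective into the dual space, hence
  surjective in finite dimension; \<open>L\<close> represents this map through the standard basis.
  The form may be non-symmetric, so the lemma gives the Reeb field as well as the gradient.\<close>

lemma nondegenerate_ex1:
  fixes f :: "'v::euclidean_space \<Rightarrow> 'v \<Rightarrow> real"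
  assumes "bilinear f" and nondeg: "\<And>v. (\<And>w. f v w = 0) \<Longrightarrow> v = 0" and "linear l"
  shows "\<exists>!v. \<forall>w. f v w = l w"
proof -
  define L where "L v = (\<Sum>b\<in>Basis. f v b *\<^sub>R b)" for v
  have L: "L v \<bullet> b = f v b" if "b \<in> Basis" for v b
    using that by (simp add: L_def inner_sum_left inner_Basis if_distrib cong: if_cong)
  have lin: "linear L"
    unfolding L_def[abs_def]
    by (intro linear_compose_sum ballI linearI)
      (simp_all add: linear_add[OF bilinear_linear(2)[OF assms(1)]] linear_scale[OF bilinear_linear(2)[OF assms(1)]]
        scaleR_add_left)
  have eqI: "f v w = f' w" if "linear f'" "\<And>b. b \<in> Basis \<Longrightarrow> f v b = f' b" for v w and f' :: "'v \<Rightarrow> real"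
    using linear_sum_Basis[OF bilinear_linear(1)[OF assms(1)], of v w] linear_sum_Basis[OF that(1), of w] that(2)
    by simp
  have "L v = 0 \<Longrightarrow> v = 0" for v
    using nondeg eqI[of "\<lambda>w. 0" v] L[of _ v] by (force intro: linear_zero)
  then have inj: "inj L" using lin linear_injective_0 by blast
  obtain v where "L v = (\<Sum>b\<in>Basis. l b *\<^sub>R b)"
    using linear_injective_imp_surjective[OF lin inj] by (metis surjD)
  then have "f v b = l b" if "b \<in> Basis" for b
    using L[OF that, of v] that by (simp add: inner_sum_left inner_Basis if_distrib cong: if_cong)
  then have v: "f v w = l w" for w using eqI[OF assms(3)] by blast
  have "v' = v" if "\<forall>w. f v' w = l w" for v'
  proof -
    have "f (v' - v) w = 0" for w
      using linear_diff[OF bilinear_linear(2)[OF assms(1)], of v' v w] v that by simp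
    then show ?thesis using nondeg by fastforce
  qed
  with v show ?thesis by blast
qed

lemma pseudo_hermitian:
  assumes "pseudo_hermitian M"
  shows "smooth_atlas (atlas M)" "linear (theta M x)" "vec.subspace (T10 M x)"
    "T10 M x \<inter> cnj_vec ` T10 M x = {0}" "\<exists>v. theta M x v \<noteq> 0"
    "theta M x v = 0 \<longleftrightarrow> v \<in> levi_dist M x"
    "v \<in> levi_dist M x \<Longrightarrow> v \<noteq> 0 \<Longrightarrow> levi_form M x v v > 0"
    "open W \<Longrightarrow> smooth_field (atlas M) W V \<Longrightarrow> smooth_fun (atlas M) W (\<lambda>x. theta M x (V x))"
proof -
  show "smooth_atlas (atlas M)" "linear (theta M x)" "vec.subspace (T10 M x)"
    "T10 M x \<inter> cnj_vec ` T10 M x = {0}"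
    using assms by (simp_all add: pseudo_hermitian_def cr_structure_def)
  have "theta M x \<noteq> (\<lambda>v. 0)" "{v. theta M x v = 0} = levi_dist M x"
    using assms by (simp_all add: pseudo_hermitian_def)
  then show "\<exists>v. theta M x v \<noteq> 0" "theta M x v = 0 \<longleftrightarrow> v \<in> levi_dist M x" by auto
  show "v \<in> levi_dist M x \<Longrightarrow> v \<noteq> 0 \<Longrightarrow> levi_form M x v v > 0"
    "open W \<Longrightarrow> smooth_field (atlas M) W V \<Longrightarrow> smooth_fun (atlas M) W (\<lambda>x. theta M x (V x))"
    using assms by (simp_all add: pseudo_hermitian_def)
qed

text \<open>The derivatives of the components of the two extensions, produced by the product rule,
  cancel against those in the Lie bracket. Only the derivatives \<open>\<theta>'\<close> of the
  components of the 1-form survive, which exhibits bilinearity and antisymmetry.\<close>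

lemma dtheta_chart:
  assumes "pseudo_hermitian M"
  obtains \<theta>' where "\<And>b. linear (\<theta>' b)"
    "\<And>v w. dtheta M x v w = ((\<Sum>b\<in>Basis. (w \<bullet> b) * \<theta>' b v) - (\<Sum>b\<in>Basis. (v \<bullet> b) * \<theta>' b w)) / 2"
proof -
  define c where "c = chart_at (atlas M) x"
  note at = pseudo_hermitian(1)[OF assms]
  note cA = chart_at[OF at, of x, folded c_def]
  let ?f = "\<lambda>b q. theta M (chart_inv c q) (coord_field (atlas M) x b (chart_inv c q))"
  define \<theta>' where "\<theta>' b = frechet_derivative (?f b) (at (snd c x))" for b
  have d: "(?f b has_derivative \<theta>' b) (at (snd c x))" for b
  proof -
    have "smooth_fun (atlas M) (fst c) (\<lambda>y. theta M y (coord_field (atlas M) x b y))"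
      unfolding c_def[symmetric]
      by (rule pseudo_hermitian(8)[OF assms atlas_chart(1)[OF at cA(1)] smooth_chart_field_const[OF at cA(1)]])
    then have "Ck_on (Suc 0) (snd c ` (fst c \<inter> fst c)) ((\<lambda>y. theta M y (coord_field (atlas M) x b y)) \<circ> chart_inv c)"
      unfolding smooth_fun_def Ck_fun_def using cA(1) by blast
    then have "Ck_on (Suc 0) (snd c ` fst c) (?f b)" by (simp add: o_def del: Ck_on.simps)
    then obtain f' where "\<And>q. q \<in> snd c ` fst c \<Longrightarrow> (?f b has_derivative f' q) (at q)"
      using Ck_on_SucE[OF atlas_chart(2)[OF at cA(1)]] by blast
    then have "?f b differentiable (at (snd c x))" using cA(2) differentiableI by blast
    then show ?thesis unfolding \<theta>'_def frechet_derivative_works .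
  qed
  show ?thesis
  proof
    show "linear (\<theta>' b)" for b using d has_derivative_linear by blast
  next
    fix v w
    define X Y where "X = extension (atlas M) x v" and "Y = extension (atlas M) x w"
    note X = extension[OF at, of x v, folded X_def] and Y = extension[OF at, of x w, folded Y_def]
    obtain X' where X': "(field_in_chart (atlas M) c X has_derivative X') (at (snd c x))"
      using field_has_derivative[OF at cA X(1)] .
    obtain Y' where Y': "(field_in_chart (atlas M) c Y has_derivative Y') (at (snd c x))"
      using field_has_derivative[OF at cA Y(1)] .
    note product = tdiff_form_field[where \<omega> = "theta M" and \<omega>' = \<theta>', OF at c_def pseudo_hermitian(2)[OF assms] d]
    have "lie_bracket (atlas M) X Y x = Y' v - X' w"
      using frechet_derivative_at[OF X'] frechet_derivative_at[OF Y']
        field_in_chart_at[OF at, of x X] field_in_chart_at[OF at, of x Y] X(2) Y(2)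
      by (simp add: lie_bracket_def Let_def c_def[symmetric])
    then show "dtheta M x v w =
        ((\<Sum>b\<in>Basis. (w \<bullet> b) * \<theta>' b v) - (\<Sum>b\<in>Basis. (v \<bullet> b) * \<theta>' b w)) / 2"
      unfolding dtheta_def Let_def X_def[symmetric] Y_def[symmetric]
      using product[OF X', of w] product[OF Y', of v] X(2) Y(2)
        linear_diff[OF pseudo_hermitian(2)[OF assms]] by simp
  qed
qed

lemma dtheta_bilinear:
  assumes "pseudo_hermitian M"
  shows "bilinear (dtheta M x)" "dtheta M x v v = 0"
proof -
  obtain \<theta>' where lin: "\<And>b. linear (\<theta>' b)" and d:
    "\<And>v w. dtheta M x v w = ((\<Sum>b\<in>Basis. (w \<bullet> b) * \<theta>' b v) - (\<Sum>b\<in>Basis. (v \<bullet> b) * \<theta>' b w)) / 2"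
    using dtheta_chart[OF assms] by blast
  show "dtheta M x v v = 0" by (simp add: d)
  show "bilinear (dtheta M x)"
    unfolding bilinear_def
    by (intro conjI allI linearI)
      (simp_all add: d linear_add[OF lin] linear_scale[OF lin] inner_add_left distrib_left distrib_right
        sum.distrib sum_distrib_left right_diff_distrib add_divide_distrib diff_divide_distrib mult_ac)
qed

section \<open>The complex structure of the Levi distribution\<close>

lemma cnj_vec_simps:
  "cnj_vec (X + Y) = cnj_vec X + cnj_vec Y" "cnj_vec (X - Y) = cnj_vec X - cnj_vec Y"
  "cnj_vec (a *s X) = cnj a *s cnj_vec X" "cnj_vec (cnj_vec X) = X"
  "cnj_vec 0 = 0" "cnj_vec (complex_vec v 0) = complex_vec v 0"
  by (simp_all add: cnj_vec_def complex_vec_def vec_eq_iff complex_eq_iff)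

lemma complex_vec_simps:
  "complex_vec (v + w) 0 = complex_vec v 0 + complex_vec w 0"
  "complex_vec (r *\<^sub>R v) 0 = complex_of_real r *s complex_vec v 0"
  "complex_vec v 0 = complex_vec w 0 \<longleftrightarrow> v = w"
  by (auto simp: complex_vec_def vec_eq_iff complex_eq_iff)

text \<open>For a real vector \<open>X + cnj_vec Y\<close>, invariance under conjugation forces
  \<open>X - Y\<close> to equal its own conjugate. It thus lies in both the holomorphic space and
  its conjugate, which meet only in 0.\<close>

lemma levi_dist_decompose:
  assumes "pseudo_hermitian M" "v \<in> levi_dist M x"
  obtains X where "X \<in> T10 M x" "complex_vec v 0 = X + cnj_vec X"
proof -
  obtain X Y where XY: "X \<in> T10 M x" "Y \<in> T10 M x" "complex_vec v 0 = X + cnj_vec Y"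
    using assms(2) by (auto simp: levi_dist_def)
  have "cnj_vec (X + cnj_vec Y) = X + cnj_vec Y"
    unfolding XY(3)[symmetric] by (rule cnj_vec_simps)
  then have "X - Y = cnj_vec (X - Y)" by (simp add: cnj_vec_simps algebra_simps)
  moreover have "X - Y \<in> T10 M x"
    using XY vec.subspace_diff[OF pseudo_hermitian(3)[OF assms(1)]] by blast
  ultimately have "X - Y = 0" using pseudo_hermitian(4)[OF assms(1), of x] by blast
  then show ?thesis using that XY by simp
qed

text \<open>Two decompositions of the same real vector differ by an element of \<open>T10\<close>
  that also lies in the conjugate space. So the decomposition is unique and the description in
  \<open>J_levi\<close> denotes.\<close>

lemma J_levi_eq:
  assumes "pseudo_hermitian M" "X \<in> T10 M x" "complex_vec v 0 = X + cnj_vec X"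
    "complex_vec w 0 = \<i> *s (X - cnj_vec X)"
  shows "J_levi M x v = w"
  unfolding J_levi_def
proof (rule the_equality)
  show "\<exists>X\<in>T10 M x. complex_vec v 0 = X + cnj_vec X \<and> complex_vec w 0 = \<i> *s (X - cnj_vec X)"
    using assms by blast
next
  fix w' assume "\<exists>X\<in>T10 M x. complex_vec v 0 = X + cnj_vec X \<and> complex_vec w' 0 = \<i> *s (X - cnj_vec X)"
  then obtain Y where Y: "Y \<in> T10 M x" "complex_vec v 0 = Y + cnj_vec Y" "complex_vec w' 0 = \<i> *s (Y - cnj_vec Y)"
    by blast
  have "X + cnj_vec X = Y + cnj_vec Y" using assms(3) Y(2) by simp
  then have "X - Y = cnj_vec (Y - X)" by (simp add: cnj_vec_simps algebra_simps)
  moreover have "X - Y \<in> T10 M x" "Y - X \<in> T10 M x"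
    using assms(2) Y(1) vec.subspace_diff[OF pseudo_hermitian(3)[OF assms(1)]] by blast+
  ultimately have "X - Y = 0" using pseudo_hermitian(4)[OF assms(1), of x] by blast
  then show "w' = w" using assms(4) Y(3) by (metis complex_vec_simps(3) eq_iff_diff_eq_0)
qed

lemma J_levi:
  assumes "pseudo_hermitian M" "v \<in> levi_dist M x"
  obtains X where "X \<in> T10 M x" "complex_vec v 0 = X + cnj_vec X"
    "complex_vec (J_levi M x v) 0 = \<i> *s (X - cnj_vec X)"
proof -
  obtain X where X: "X \<in> T10 M x" "complex_vec v 0 = X + cnj_vec X"
    using levi_dist_decompose[OF assms] .
  \<comment> \<open>\<open>X - cnj_vec X\<close> is 2i times the imaginary part of \<open>X\<close>;
    multiplying by i gives the real vector \<open>- 2 *\<^sub>R im_vec X\<close>.\<close>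
  define w where "w = - 2 *\<^sub>R im_vec X"
  have w: "complex_vec w 0 = \<i> *s (X - cnj_vec X)"
    by (simp add: w_def complex_vec_def im_vec_def cnj_vec_def vec_eq_iff complex_eq_iff)
  then show ?thesis using that X J_levi_eq[OF assms(1) X w] by blast
qed

lemma J_levi_in_levi_dist:
  assumes "pseudo_hermitian M" "v \<in> levi_dist M x"
  shows "J_levi M x v \<in> levi_dist M x"
proof -
  obtain X where X: "X \<in> T10 M x" "complex_vec (J_levi M x v) 0 = \<i> *s (X - cnj_vec X)"
    using J_levi[OF assms] by metis
  have "complex_vec (J_levi M x v) 0 = \<i> *s X + cnj_vec (\<i> *s X)"
    using X(2) by (simp add: cnj_vec_simps vec.scale_right_diff_distrib)
  then show ?thesis
    using vec.subspace_scale[OF pseudo_hermitian(3)[OF assms(1)] X(1)] by (auto simp: levi_dist_def)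
qed

lemma J_levi_linear:
  assumes "pseudo_hermitian M" "v \<in> levi_dist M x" "w \<in> levi_dist M x"
  shows "J_levi M x (v + w) = J_levi M x v + J_levi M x w"
    "J_levi M x (r *\<^sub>R v) = r *\<^sub>R J_levi M x v"
proof -
  obtain X where X: "X \<in> T10 M x" "complex_vec v 0 = X + cnj_vec X"
    "complex_vec (J_levi M x v) 0 = \<i> *s (X - cnj_vec X)" using J_levi[OF assms(1,2)] .
  obtain Y where Y: "Y \<in> T10 M x" "complex_vec w 0 = Y + cnj_vec Y"
    "complex_vec (J_levi M x w) 0 = \<i> *s (Y - cnj_vec Y)" using J_levi[OF assms(1,3)] .
  note sub = pseudo_hermitian(3)[OF assms(1), of x]
  show "J_levi M x (v + w) = J_levi M x v + J_levi M x w"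
    by (rule J_levi_eq[OF assms(1) vec.subspace_add[OF sub X(1) Y(1)]])
      (simp_all add: complex_vec_simps X Y cnj_vec_simps vec.scale_right_diff_distrib vec.scale_right_distrib)
  show "J_levi M x (r *\<^sub>R v) = r *\<^sub>R J_levi M x v"
    by (rule J_levi_eq[OF assms(1) vec.subspace_scale[OF sub X(1), of "complex_of_real r"]])
      (simp_all add: complex_vec_simps X cnj_vec_simps vec.scale_right_diff_distrib vec.scale_right_distrib mult.commute)
qed

text \<open>Positivity of the Levi form makes the exterior derivative nondegenerate on the Levi
  distribution, since pairing \<open>v\<close> with its image under \<open>J_levi\<close> gives a
  positive number. Adding the square of the contact form repairs the remaining direction, and the
  Reeb vector is the one that represents \<open>theta M x\<close> with respect to the resulting
  form.\<close>

lemma reeb: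
  assumes "pseudo_hermitian M"
  shows "theta M x (reeb M x) = 1"
proof -
  note lin = pseudo_hermitian(2)[OF assms, of x]
  note dt = dtheta_bilinear[OF assms, of x]
  have H: "v = 0" if "theta M x v = 0" "\<And>w. w \<in> levi_dist M x \<Longrightarrow> dtheta M x v w = 0" for v
  proof (rule ccontr)
    assume "v \<noteq> 0"
    moreover have v: "v \<in> levi_dist M x" using that(1) pseudo_hermitian(6)[OF assms] by blast
    ultimately have "dtheta M x v (J_levi M x v) > 0"
      using pseudo_hermitian(7)[OF assms] by (simp add: levi_form_def)
    then show False using that(2)[OF J_levi_in_levi_dist[OF assms v]] by simp
  qed
  let ?f = "\<lambda>v w. dtheta M x v w + theta M x v * theta M x w"
  have "bilinear ?f"
    unfolding bilinear_def
    by (intro conjI allI linear_compose_add linearI)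
      (simp_all add: linear_add[OF lin] linear_scale[OF lin] linear_add[OF bilinear_linear(1)[OF dt(1)]]
        linear_add[OF bilinear_linear(2)[OF dt(1)]] linear_scale[OF bilinear_linear(1)[OF dt(1)]]
        linear_scale[OF bilinear_linear(2)[OF dt(1)]] algebra_simps)
  moreover have "v = 0" if "\<And>w. ?f v w = 0" for v
  proof -
    have "theta M x v = 0" using that[of v] dt(2) by simp
    then show ?thesis using H that by simp
  qed
  ultimately obtain v where v: "\<And>w. ?f v w = theta M x w"
    using nondegenerate_ex1[of ?f "theta M x"] lin by blast
  \<comment> \<open>Inserting \<open>w = v\<close> kills the antisymmetric part and leaves 0 and 1
    as possible values. The value 0 would put \<open>v\<close> into the Levi distribution and into
    the radical there, so \<open>v = 0\<close> and the contact form would vanish.\<close>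
  have "theta M x v * theta M x v = theta M x v" using v[of v] dt(2) by simp
  moreover have "theta M x v \<noteq> 0"
  proof
    assume 0: "theta M x v = 0"
    then have "v = 0" using H v pseudo_hermitian(6)[OF assms] by (metis add.right_neutral mult_zero_left)
    then have "theta M x w = 0" for w using v[of w] linear_0[OF bilinear_linear(2)[OF dt(1)]] 0 by simp
    then show False using pseudo_hermitian(5)[OF assms] by blast
  qed
  ultimately have v1: "theta M x v = 1" by simp
  have "theta M x (reeb M x) = 1 \<and> (\<forall>w. dtheta M x (reeb M x) w = 0)"
    unfolding reeb_def
  proof (rule theI[where a = v])
    show "theta M x v = 1 \<and> (\<forall>w. dtheta M x v w = 0)" using v v1 by simp
    fix v' assume v': "theta M x v' = 1 \<and> (\<forall>w. dtheta M x v' w = 0)"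
    have "v' - v = 0"
      by (rule H) (use v v' v1 in \<open>simp_all add: linear_diff[OF lin] linear_diff[OF bilinear_linear(2)[OF dt(1)]]\<close>)
    then show "v' = v" by simp
  qed
  then show ?thesis by simp
qed

section \<open>Bilinearity and positivity of the metric, and the scaling of gradients\<close>

lemma proj_H:
  assumes "pseudo_hermitian M"
  shows "proj_H M x v \<in> levi_dist M x" "linear (proj_H M x)"
proof -
  note lin = pseudo_hermitian(2)[OF assms, of x]
  have "theta M x (proj_H M x v) = 0"
    by (simp add: proj_H_def linear_diff[OF lin] linear_scale[OF lin] reeb[OF assms])
  then show "proj_H M x v \<in> levi_dist M x" using pseudo_hermitian(6)[OF assms] by blast
  show "linear (proj_H M x)"
    by (rule linearI) (simp_all add: proj_H_def linear_add[OF lin] linear_scale[OF lin] algebra_simps)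
qed

lemma bilinear_webster:
  assumes "pseudo_hermitian M"
  shows "bilinear (webster M x)"
proof -
  note lin = pseudo_hermitian(2)[OF assms, of x]
  note dt = dtheta_bilinear(1)[OF assms, of x]
  note P = proj_H[OF assms, of x]
  \<comment> \<open>\<open>J_levi\<close> is linear only on the Levi distribution; precomposing with
    the projection gives a map that is linear on the whole tangent space.\<close>
  have J: "linear (\<lambda>w. J_levi M x (proj_H M x w))"
  proof (rule linearI)
    show "J_levi M x (proj_H M x (v + w)) = J_levi M x (proj_H M x v) + J_levi M x (proj_H M x w)" for v w
      unfolding linear_add[OF P(2)] by (rule J_levi_linear(1)[OF assms P(1) P(1)])
    show "J_levi M x (proj_H M x (r *\<^sub>R v)) = r *\<^sub>R J_levi M x (proj_H M x v)" for v r
      unfolding linear_scale[OF P(2)] by (rule J_levi_linear(2)[OF assms P(1) P(1)])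
  qed
  have theta: "linear (\<lambda>v. r * theta M x v)" "linear (\<lambda>v. theta M x v * r)" for r
    by (rule linearI; simp add: linear_add[OF lin] linear_scale[OF lin] algebra_simps)+
  show ?thesis
    unfolding bilinear_def webster_def levi_form_def
  proof (intro conjI allI linear_compose_add theta)
    show "linear (\<lambda>w. dtheta M x (proj_H M x v) (J_levi M x (proj_H M x w)))" for v
      using linear_compose[OF J bilinear_linear(1)[OF dt]] by (simp add: o_def)
    show "linear (\<lambda>v. dtheta M x (proj_H M x v) (J_levi M x (proj_H M x w)))" for w
      using linear_compose[OF P(2) bilinear_linear(2)[OF dt]] by (simp add: o_def)
  qed
qed

lemma webster_pos:
  assumes "pseudo_hermitian M" "v \<noteq> 0"
  shows "webster M x v v > 0"
proof (cases "proj_H M x v = 0")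
  case True
  then have "theta M x v \<noteq> 0" using assms(2) by (auto simp: proj_H_def)
  moreover have "levi_form M x 0 0 = 0"
    using linear_0[OF bilinear_linear(2)[OF dtheta_bilinear(1)[OF assms(1)]]] by (simp add: levi_form_def)
  ultimately show ?thesis using True by (auto simp: webster_def zero_less_mult_iff)
next
  case False
  then have "levi_form M x (proj_H M x v) (proj_H M x v) > 0"
    using pseudo_hermitian(7)[OF assms(1) proj_H(1)[OF assms(1)]] by blast
  then show ?thesis by (simp add: webster_def add_pos_nonneg)
qed

lemma webster_norm_scaleR:
  assumes "pseudo_hermitian M"
  shows "webster_norm M x (r *\<^sub>R v) = \<bar>r\<bar> * webster_norm M x v"
proof -
  note b = bilinear_webster[OF assms, of x]
  have "webster M x (r *\<^sub>R v) (r *\<^sub>R v) = r\<^sup>2 * webster M x v v"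
    by (simp add: linear_scale[OF bilinear_linear(1)[OF b]] linear_scale[OF bilinear_linear(2)[OF b]] power2_eq_square)
  then show ?thesis by (simp add: webster_norm_def real_sqrt_mult)
qed

lemma webster_norm_nonneg: "pseudo_hermitian M \<Longrightarrow> webster_norm M x v \<ge> 0"
  using webster_pos[of M v x] bilinear_lzero[OF bilinear_webster, of M x 0]
  by (cases "v = 0") (simp_all add: webster_norm_def less_imp_le)

text \<open>A definite metric represents each linear form by exactly one vector. The multiple of the
  gradient of \<open>\<gamma>\<close> represents the differential of \<open>u\<close>, so it must be
  the vector that \<open>gradient\<close> describes.\<close>

lemma gradient_scaleR:
  assumes "pseudo_hermitian M" "linear (tdiff (atlas M) \<gamma> x)"
    and "\<And>v. tdiff (atlas M) u x v = r * tdiff (atlas M) \<gamma> x v"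
  shows "gradient M u x = r *\<^sub>R gradient M \<gamma> x" "hgradient M u x = r *\<^sub>R hgradient M \<gamma> x"
proof -
  note b = bilinear_webster[OF assms(1), of x]
  have nondeg: "v = 0" if "\<And>w. webster M x v w = 0" for v
    using webster_pos[OF assms(1), of v x] that[of v] by fastforce
  have "\<exists>!w. \<forall>v. webster M x w v = tdiff (atlas M) \<gamma> x v"
    by (rule nondegenerate_ex1[OF b nondeg assms(2)])
  then have \<gamma>: "\<forall>v. webster M x (gradient M \<gamma> x) v = tdiff (atlas M) \<gamma> x v"
    unfolding gradient_def by (rule theI')
  have lin: "linear (tdiff (atlas M) u x)"
    by (rule linearI) (simp_all add: assms(3) linear_add[OF assms(2)] linear_scale[OF assms(2)] algebra_simps)
  have "\<exists>!w. \<forall>v. webster M x w v = tdiff (atlas M) u x v"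
    by (rule nondegenerate_ex1[OF b nondeg lin])
  moreover have "\<forall>v. webster M x (r *\<^sub>R gradient M \<gamma> x) v = tdiff (atlas M) u x v"
    using \<gamma> by (simp add: linear_scale[OF bilinear_linear(2)[OF b]] assms(3))
  ultimately show g: "gradient M u x = r *\<^sub>R gradient M \<gamma> x"
    unfolding gradient_def by (rule the1_equality)
  then show "hgradient M u x = r *\<^sub>R hgradient M \<gamma> x"
    by (simp add: hgradient_def linear_scale[OF proj_H(2)[OF assms(1)]])
qed

section \<open>Sub-Laplacian and complex Hessian as Hermitian forms\<close>

lemma re_im_vec_simps:
  "re_vec (cnj_vec X) = re_vec X" "im_vec (cnj_vec X) = - im_vec X"
  "re_vec (X + Y) = re_vec X + re_vec Y" "im_vec (X + Y) = im_vec X + im_vec Y"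
  "re_vec (a *s X) = Re a *\<^sub>R re_vec X - Im a *\<^sub>R im_vec X"
  "im_vec (a *s X) = Re a *\<^sub>R im_vec X + Im a *\<^sub>R re_vec X" "re_vec 0 = 0" "im_vec 0 = 0"
  by (simp_all add: re_vec_def im_vec_def cnj_vec_def vec_eq_iff)

lemma bilinear_simps:
  assumes "bilinear b"
  shows "b (v + v') w = b v w + b v' w" "b v (w + w') = b v w + b v w'"
    "b (v - v') w = b v w - b v' w" "b v (w - w') = b v w - b v w'"
    "b (r *\<^sub>R v) w = r *\<^sub>R b v w" "b v (r *\<^sub>R w) = r *\<^sub>R b v w"
    "b (- v) w = - b v w" "b v (- w) = - b v w" "b 0 w = 0" "b v 0 = 0"
  using assms by (simp_all add: bilinear_ladd bilinear_radd bilinear_lsub bilinear_rsub bilinear_lmul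
    bilinear_rmul bilinear_lneg bilinear_rneg bilinear_lzero bilinear_rzero)

lemma cbilinear_simps:
  assumes "bilinear b"
  shows "cbilinear b (X + Y) Z = cbilinear b X Z + cbilinear b Y Z"
    "cbilinear b X (Y + Z) = cbilinear b X Y + cbilinear b X Z"
    "cbilinear b (a *s X) Y = a * cbilinear b X Y" "cbilinear b X (a *s Y) = a * cbilinear b X Y"
    "cbilinear b 0 Y = 0" "cbilinear b X 0 = 0"
  by (simp_all add: cbilinear_def re_im_vec_simps bilinear_simps[OF assms] complex_eq_iff algebra_simps)

text \<open>The mixed terms in real and imaginary parts go to the imaginary part of the value. Hence
  comparison of the real Hessians on the diagonal is enough, without any symmetry.\<close>

lemma Re_cbilinear_cnj:
  assumes "bilinear b"
  shows "Re (cbilinear b X (cnj_vec X)) = b (re_vec X) (re_vec X) + b (im_vec X) (im_vec X)"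
    "Re (cbilinear b (cnj_vec X) X) = b (re_vec X) (re_vec X) + b (im_vec X) (im_vec X)"
  by (simp_all add: cbilinear_def re_im_vec_simps bilinear_simps[OF assms])

text \<open>Collapses the double sum over a frame, as it occurs in \<open>re_hessian\<close>, into
  one value of the form at a vector and its conjugate.\<close>

lemma cbilinear_sum:
  assumes "bilinear b" "finite I"
  shows "cbilinear b (\<Sum>i\<in>I. c i *s e i) (cnj_vec (\<Sum>i\<in>I. c i *s e i)) =
    (\<Sum>k\<in>I. \<Sum>l\<in>I. cbilinear b (e k) (cnj_vec (e l)) * c k * cnj (c l))"
proof -
  have 1: "cbilinear b (\<Sum>i\<in>I. c i *s e i) Y = (\<Sum>i\<in>I. c i * cbilinear b (e i) Y)" for Y
    using assms(2) by (induction I rule: finite_induct) (simp_all add: cbilinear_simps[OF assms(1)])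
  have 2: "cbilinear b X (cnj_vec (\<Sum>i\<in>I. c i *s e i)) = (\<Sum>i\<in>I. cnj (c i) * cbilinear b X (cnj_vec (e i)))" for X
    using assms(2) by (induction I rule: finite_induct) (simp_all add: cbilinear_simps[OF assms(1)] cnj_vec_simps)
  show ?thesis unfolding 1 unfolding 2 by (simp add: sum_distrib_left mult_ac)
qed

text \<open>The unspecified choices in the two definitions are harmless, since both sides use the same choice of frame and of coefficients.\<close>

lemma hessian_traces_mono:
  assumes "bilinear (hessian M D u x)" "bilinear (hessian M D \<gamma> x)"
    and "\<And>v. hessian M D u x v v \<le> r * hessian M D \<gamma> x v v"
  shows "sub_laplacian M D u x \<le> r * sub_laplacian M D \<gamma> x"
    and "re_hessian M D u x X \<le> r * re_hessian M D \<gamma> x X"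
proof -
  define e where "e = (SOME e. unitary_frame_at M x e)"
  have "sub_laplacian M D f x = (\<Sum>k<cr_dim M. 2 * (hessian M D f x (re_vec (e k)) (re_vec (e k)) +
      hessian M D f x (im_vec (e k)) (im_vec (e k))))" if "bilinear (hessian M D f x)" for f
    by (simp add: sub_laplacian_def Let_def e_def[symmetric] Re_cbilinear_cnj[OF that])
  then show "sub_laplacian M D u x \<le> r * sub_laplacian M D \<gamma> x"
    using assms by (auto simp: sum_distrib_left distrib_left mult.left_commute[of r] intro!: sum_mono add_mono)
  \<comment> \<open>\<open>Y\<close> is assembled from the very frame and coefficients chosen in
    \<open>re_hessian\<close>, so \<open>re_hessian\<close> at \<open>X\<close> is the sum of the
    Hessian's diagonal values at the real and imaginary parts of \<open>Y\<close>.\<close>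
  define Y where "Y = (\<Sum>k<cr_dim M. (SOME c. X = (\<Sum>k<cr_dim M. c k *s e k)) k *s e k)"
  have "re_hessian M D f x X = hessian M D f x (re_vec Y) (re_vec Y) + hessian M D f x (im_vec Y) (im_vec Y)"
    if "bilinear (hessian M D f x)" for f
    unfolding Re_cbilinear_cnj(1)[OF that, symmetric] Y_def cbilinear_sum[OF that finite_lessThan]
    by (simp add: re_hessian_def Let_def e_def[symmetric] sum.distrib)
  then show "re_hessian M D u x X \<le> r * re_hessian M D \<gamma> x X"
    using assms by (auto simp: distrib_left intro!: add_mono)
qed

section \<open>The comparison function\<close>

locale growth_function =
  fixes G :: "real \<Rightarrow> real"
  assumes smooth: "smooth_on {0..} G"
    and pos0: "G 0 > 0"
    and deriv_nonneg: "\<And>t. t \<ge> 0 \<Longrightarrow> vector_derivative G (at t within {0..}) \<ge> 0"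
    and not_integrable: "\<not> (\<exists>a\<ge>0. set_integrable lborel {a..} (\<lambda>t. G t powr (- 1 / 2)))"
begin

text \<open>For negative \<open>t\<close> the interval is empty and the value is 0, so monotonicity
  and nonnegativity hold on the whole real line.\<close>

definition \<psi> :: "real \<Rightarrow> real" where "\<psi> t = integral {0..t} (\<lambda>s. G s powr (- 1 / 2))"

lemma G_differentiable: "t \<ge> 0 \<Longrightarrow> G differentiable (at t within {0..})"
  using smooth[unfolded smooth_on_def, rule_format, of "Suc 0"] by simp

lemma G_deriv:
  assumes "t > 0"
  obtains d where "(G has_real_derivative d) (at t)" "d \<ge> 0"
proof -
  have "(G has_vector_derivative vector_derivative G (at t within {0..})) (at t within {0..})"
    using G_differentiable[of t] assms by (simp add: vector_derivative_works)
  moreover have "at t within {0..} = at t" using assms by (intro at_within_interior) simp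
  ultimately show ?thesis
    using that deriv_nonneg[of t] assms by (simp add: has_real_derivative_iff_has_vector_derivative)
qed

lemma G_continuous: "continuous_on {0..} G"
  using G_differentiable by (intro differentiable_imp_continuous_on) (simp add: differentiable_on_def)

lemma G_mono:
  assumes "0 \<le> s" "s \<le> t"
  shows "G s \<le> G t"
proof (rule DERIV_nonneg_imp_increasing_open[OF assms(2)])
  show "\<exists>y. DERIV G x :> y \<and> 0 \<le> y" if "s < x" "x < t" for x
    using G_deriv[of x] that assms(1) by (metis le_less_trans)
  show "continuous_on {s..t} G" using continuous_on_subset[OF G_continuous] assms(1) by simp
qed

lemma G_pos: "t \<ge> 0 \<Longrightarrow> G t > 0"
  using G_mono[of 0 t] pos0 by simp

lemma powr_continuous: "continuous_on {0..} (\<lambda>s. G s powr (- 1 / 2))"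
  by (intro continuous_on_powr G_continuous continuous_on_const) (use G_pos in force)

lemma powr_integrable: "(\<lambda>s. G s powr (- 1 / 2)) integrable_on {0..t}"
  by (intro integrable_continuous_real continuous_on_subset[OF powr_continuous]) auto

lemma \<psi>_deriv_within: "0 \<le> t \<Longrightarrow> t \<le> b \<Longrightarrow> (\<psi> has_real_derivative G t powr (- 1 / 2)) (at t within {0..b})"
  unfolding \<psi>_def[abs_def]
  by (intro integral_has_real_derivative continuous_on_subset[OF powr_continuous]) auto

lemma \<psi>_continuous: "continuous_on {0..b} \<psi>"
  using \<psi>_deriv_within by (intro DERIV_continuous_on) auto

lemma \<psi>_deriv: "t > 0 \<Longrightarrow> (\<psi> has_real_derivative G t powr (- 1 / 2)) (at t)"
  using \<psi>_deriv_within[of t "t + 1"] at_within_interior[of t "{0..t + 1}"] by simp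

text \<open>This is the concavity of \<open>\<psi>\<close> for positive arguments: its derivative is
  a negative power of the nondecreasing function \<open>G\<close>.\<close>

lemma powr_deriv:
  assumes "t > 0"
  obtains d where "((\<lambda>s. G s powr (- 1 / 2)) has_real_derivative d) (at t)" "d \<le> 0"
proof -
  obtain d where d: "(G has_real_derivative d) (at t)" "d \<ge> 0" using G_deriv[OF assms] .
  have "((\<lambda>s. G s powr (- 1 / 2)) has_real_derivative (- 1 / 2) * G t powr (- 1 / 2 - 1) * d) (at t)"
    by (rule DERIV_chain2[OF has_real_derivative_powr d(1)]) (use G_pos[of t] assms in simp)
  then show ?thesis using that d(2) by simp
qed

lemma \<psi>_mono: "mono \<psi>"
  unfolding \<psi>_def[abs_def]
  by (intro monoI integral_subset_le powr_integrable) auto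

lemma \<psi>_nonneg: "\<psi> t \<ge> 0"
  unfolding \<psi>_def by (intro integral_nonneg powr_integrable) auto

text \<open>A bounded monotone \<open>\<psi>\<close> has a limit at infinity. The fundamental
  theorem for nonnegative integrands then makes \<open>G t powr (- 1 / 2)\<close> integrable near
  infinity, contrary to assumption.\<close>

lemma \<psi>_unbounded: "\<exists>n::nat. \<psi> (real n) > b"
proof (rule ccontr)
  assume "\<not> ?thesis"
  then have le: "\<psi> (real n) \<le> b" for n :: nat by (simp add: not_less)
  have "incseq (\<lambda>n. \<psi> (real n))" using \<psi>_mono by (auto simp: incseq_def mono_def)
  then obtain L where L: "(\<lambda>n. \<psi> (real n)) \<longlonglongrightarrow> L" using incseq_convergent le by metis
  then have top: "(\<psi> \<longlongrightarrow> L) at_top"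
    using \<psi>_mono by (intro tendsto_at_topI_sequentially_real) auto
  have one: "(\<psi> \<longlongrightarrow> \<psi> 1) (at_right 1)"
    using DERIV_isCont[OF \<psi>_deriv[of 1]] by (simp add: isCont_def filterlim_at_split)
  \<comment> \<open>The lower end 1 keeps away from 0, where two-sided differentiability fails; the
    closed half-line from 2 lies inside this open interval.\<close>
  have "set_integrable lborel (einterval (ereal 1) \<infinity>) (\<lambda>t. G t powr (- 1 / 2))"
  proof (rule interval_integral_FTC_nonneg(1))
    show "((\<psi> \<circ> real_of_ereal) \<longlongrightarrow> \<psi> 1) (at_right (ereal 1))"
      using one by (simp only: ereal_tendsto_simps)
    show "((\<psi> \<circ> real_of_ereal) \<longlongrightarrow> L) (at_left \<infinity>)"
      using top by (simp only: ereal_tendsto_simps)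
    show "isCont (\<lambda>t. G t powr (- 1 / 2)) x" if "ereal 1 < ereal x" for x
    proof -
      have "x > 0" using that by simp
      then show ?thesis using powr_deriv[of x] DERIV_isCont by blast
    qed
    show "(\<psi> has_real_derivative G x powr (- 1 / 2)) (at x)" if "ereal 1 < ereal x" for x
      using that by (intro \<psi>_deriv) simp
  qed auto
  then have "set_integrable lborel {2..} (\<lambda>t. G t powr (- 1 / 2))"
    by (rule set_integrable_subset) (auto simp: einterval_def)
  then show False using not_integrable by fastforce
qed

text \<open>For \<open>t > 0\<close> the product is the square root of
  \<open>t * G (sqrt t) / G t\<close>, the quantity whose upper limit is finite.\<close>

lemma growth_bound:
  assumes "Limsup at_top (\<lambda>t. ereal (t * G (sqrt t) / G t)) < \<infinity>"
  obtains C T where "T \<ge> 0" "\<And>t. t > T \<Longrightarrow> G t powr (- 1 / 2) * (sqrt t * sqrt (G (sqrt t))) \<le> C"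
proof -
  obtain C :: nat where "Limsup at_top (\<lambda>t. ereal (t * G (sqrt t) / G t)) < ereal (real C)"
    using less_PInf_Ex_of_nat[THEN iffD1] assms by auto
  then have "\<forall>\<^sub>F t in at_top. ereal (t * G (sqrt t) / G t) < ereal (real C)" by (rule Limsup_lessD)
  then obtain T where T: "\<And>t. t \<ge> T \<Longrightarrow> t * G (sqrt t) / G t < real C"
    by (auto simp: eventually_at_top_linorder)
  show ?thesis
  proof
    show "max T 0 \<ge> 0" by simp
    fix t assume t: "t > max T 0"
    have "G t powr (- 1 / 2) * (sqrt t * sqrt (G (sqrt t))) = sqrt (t * G (sqrt t) / G t)"
      using G_pos[of t] t by (simp add: powr_minus powr_half_sqrt real_sqrt_mult real_sqrt_divide field_simps)
    also have "\<dots> \<le> sqrt (real C)" using T[of t] t by simp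
    finally show "G t powr (- 1 / 2) * (sqrt t * sqrt (G (sqrt t))) \<le> sqrt (real C)" .
  qed
qed

end

section \<open>The maximizing sequence\<close>

text \<open>The penalty tends to infinity along with \<open>\<gamma>\<close> while \<open>u\<close>
  is bounded above, so off a large compact set the penalized function stays below its value at some
  fixed point. A maximum over that compact set is therefore global.\<close>

lemma penalized_max:
  fixes u \<gamma> :: "'a::t2_space \<Rightarrow> real"
  assumes "continuous_on UNIV u" "continuous_on UNIV \<gamma>" "bdd_above (range u)"
    and "\<And>x. \<gamma> x \<ge> 0" and proper: "\<And>\<eta>. \<eta> > 0 \<Longrightarrow> outside_compact (\<lambda>x. \<gamma> x > \<eta>)"
    and \<psi>: "\<And>b. continuous_on {0..b} \<psi>" "mono \<psi>" "\<And>b. \<exists>n::nat. \<psi> (real n) > b"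
    and "\<epsilon> > 0"
  obtains z where "\<And>y. u y - \<epsilon> * \<psi> (\<gamma> y) \<le> u z - \<epsilon> * \<psi> (\<gamma> z)"
proof -
  define w where "w y = u y - \<epsilon> * \<psi> (\<gamma> y)" for y
  fix x0 :: 'a
  \<comment> \<open>The threshold is chosen so that the penalty at level \<open>n\<close> alone
    already pushes the function below \<open>w x0\<close>. The level \<open>real n + 1\<close> used
    next is positive even when \<open>n = 0\<close>, as properness requires.\<close>
  obtain n :: nat where n: "\<psi> (real n) > ((SUP y. u y) - w x0) / \<epsilon>" using \<psi>(3) by blast
  obtain K where K: "compact K" "\<And>x. x \<notin> K \<Longrightarrow> \<gamma> x > real n + 1"
    using proper[of "real n + 1"] by (auto simp: outside_compact_def)
  have out: "w x < w x0" if "x \<notin> K" for x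
  proof -
    have "\<psi> (real n) \<le> \<psi> (\<gamma> x)" using K(2)[OF that] by (intro monoD[OF \<psi>(2)]) simp
    then have "(SUP y. u y) - w x0 < \<epsilon> * \<psi> (\<gamma> x)" using n assms(9) by (simp add: field_simps)
      (smt (verit) mult_left_mono)
    moreover have "u x \<le> (SUP y. u y)" using assms(3) by (rule cSUP_upper[OF UNIV_I])
    ultimately show ?thesis by (simp add: w_def)
  qed
  then have x0: "x0 \<in> K" by blast
  have "bounded (\<gamma> ` K)"
    by (intro compact_imp_bounded compact_continuous_image K(1) continuous_on_subset[OF assms(2)]) auto
  then obtain b where b: "\<And>y. y \<in> K \<Longrightarrow> \<bar>\<gamma> y\<bar> \<le> b" by (auto simp: bounded_iff)
  \<comment> \<open>Continuity of \<open>\<psi>\<close> is available only on compact intervals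
    starting at 0, so the values of \<open>\<gamma>\<close> on \<open>K\<close> are enclosed in
    one.\<close>
  have "\<gamma> ` K \<subseteq> {0..b}" using b assms(4) by (auto simp: abs_le_iff)
  then have "continuous_on K (\<lambda>y. \<psi> (\<gamma> y))"
    using continuous_on_compose2[OF \<psi>(1) continuous_on_subset[OF assms(2)]] by blast
  then have "continuous_on K w"
    unfolding w_def[abs_def] by (intro continuous_intros continuous_on_subset[OF assms(1)]) auto
  then obtain z where z: "z \<in> K" "\<And>y. y \<in> K \<Longrightarrow> w y \<le> w z"
    using continuous_attains_sup[OF K(1)] x0 by blast
  have "w y \<le> w z" for y using z(2) out[of y] x0 by fastforce
  then show ?thesis unfolding w_def by (rule that)
qed

text \<open>Here \<open>g\<close> plays the derivative of \<open>\<psi>\<close> and \<open>h\<close>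
  the weight in the bounds on \<open>\<gamma>\<close>; bounded \<open>g t * h t\<close> and
  vanishing penalties give \<open>r k * h (\<gamma> (x k))\<close> tending to 0. The alternative
  \<open>r k = 0 \<or> x k \<notin> K\<close> unites the two cases: a constant sequence at a maximum
  point, and a sequence leaving every compact set.\<close>

lemma maximizing_sequence:
  fixes M :: "('a::t2_space, 'n::finite) ph_structure"
  assumes at: "smooth_atlas (atlas M)" and lc: "linear_connection (atlas M) D"
    and u: "Ck_fun (atlas M) 2 UNIV u" "bdd_above (range u)" and \<gamma>: "Ck_fun (atlas M) 2 UNIV \<gamma>"
    and nonneg: "\<And>x. \<gamma> x \<ge> 0" and proper: "\<And>\<eta>. \<eta> > 0 \<Longrightarrow> outside_compact (\<lambda>x. \<gamma> x > \<eta>)"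
    and \<psi>: "\<And>b. continuous_on {0..b} \<psi>" "mono \<psi>" "\<And>b. \<exists>n::nat. \<psi> (real n) > b" "\<And>t. \<psi> t \<ge> 0"
      "\<And>t. t > 0 \<Longrightarrow> (\<psi> has_real_derivative g t) (at t)"
    and g: "\<And>t. t > 0 \<Longrightarrow> \<exists>d\<le>0. (g has_real_derivative d) (at t)" "\<And>t. g t \<ge> 0"
    and h: "\<And>t. t > T \<Longrightarrow> g t * h t \<le> C" "\<And>t. t \<ge> 0 \<Longrightarrow> h t \<ge> 0" "T \<ge> 0"
  obtains x :: "nat \<Rightarrow> 'a" and r where "(\<lambda>k. u (x k)) \<longlonglongrightarrow> (SUP y. u y)" "\<And>k. r k \<ge> 0"
    "\<And>K. compact K \<Longrightarrow> \<forall>\<^sub>F k in sequentially. r k = 0 \<or> x k \<notin> K"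
    "(\<lambda>k. r k * h (\<gamma> (x k))) \<longlonglongrightarrow> 0"
    "\<forall>\<^sub>F k in sequentially. \<forall>v. tdiff (atlas M) u (x k) v = r k * tdiff (atlas M) \<gamma> (x k) v"
    "\<forall>\<^sub>F k in sequentially. \<forall>v. hessian M D u (x k) v v \<le> r k * hessian M D \<gamma> (x k) v v"
proof (cases "\<exists>z. u z = (SUP y. u y)")
  case True
  then obtain z where z: "u z = (SUP y. u y)" by blast
  have "u y \<le> u z" for y unfolding z using u(2) by (rule cSUP_upper[OF UNIV_I])
  \<comment> \<open>With comparison function 0, and \<open>u\<close> itself in the place of
    \<open>\<gamma>\<close>, the comparison lemma reduces to the first and second order conditions
    at a maximum.\<close>
  then have "tdiff (atlas M) u z v = 0" "hessian M D u z v v \<le> 0" for v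
    using hessian_comparison[OF at lc u(1) u(1), of UNIV z "\<lambda>t. 0" "\<lambda>t. 0" 0] by auto
  then show ?thesis using z by (intro that[of "\<lambda>k. z" "\<lambda>k. 0"]) auto
next
  case False
  define S where "S = (SUP y. u y)"
  have le: "u y \<le> S" for y unfolding S_def using u(2) by (rule cSUP_upper[OF UNIV_I])
  have less: "u y < S" for y using le[of y] False by (metis S_def le_less)
  note cont = C2_continuous[OF at u(1)] C2_continuous[OF at \<gamma>]
  have "\<exists>z. \<forall>y. u y - 1 / (real k + 1) * \<psi> (\<gamma> y) \<le> u z - 1 / (real k + 1) * \<psi> (\<gamma> z)" for k
    by (rule penalized_max[OF cont u(2) nonneg proper \<psi>(1-3), of "1 / (real k + 1)"]) auto
  then obtain x where x: "\<And>k y. u y - 1 / (real k + 1) * \<psi> (\<gamma> y) \<le> u (x k) - 1 / (real k + 1) * \<psi> (\<gamma> (x k))"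
    by metis
  have eps: "(\<lambda>k. 1 / (real k + 1)) \<longlonglongrightarrow> 0" by real_asymp
  have lim: "(\<lambda>k. u (x k)) \<longlonglongrightarrow> S"
  proof (rule order_tendstoI)
    fix a assume "a < S"
    then obtain y where y: "a < u y" unfolding S_def using less_cSUP_iff[OF _ u(2)] by auto
    \<comment> \<open>For the fixed point \<open>y\<close> the penalty fades out, and
      \<open>u (x k)\<close> is at least the penalized value at \<open>x k\<close>, hence at least
      the one at \<open>y\<close>.\<close>
    have "(\<lambda>k. u y - 1 / (real k + 1) * \<psi> (\<gamma> y)) \<longlonglongrightarrow> u y - 0 * \<psi> (\<gamma> y)"
      by (intro tendsto_intros eps)
    then have "\<forall>\<^sub>F k in sequentially. a < u y - 1 / (real k + 1) * \<psi> (\<gamma> y)"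
      using y order_tendstoD(1) by fastforce
    then show "\<forall>\<^sub>F k in sequentially. a < u (x k)"
    proof eventually_elim
      case (elim k)
      have "0 \<le> 1 / (real k + 1) * \<psi> (\<gamma> (x k))" using \<psi>(4) by simp
      then show ?case using elim x[of y k] by linarith
    qed
  next
    fix a assume "S < a"
    then show "\<forall>\<^sub>F k in sequentially. u (x k) < a"
      by (intro always_eventually allI) (rule less_trans[OF less])
  qed
  \<comment> \<open>On a compact set \<open>u\<close> has a maximum, which is strictly below the
    unattained supremum, whereas \<open>u (x k)\<close> tends to the supremum.\<close>
  have leave: "\<forall>\<^sub>F k in sequentially. x k \<notin> K" if K: "compact K" for K
  proof (cases "K = {}")
    case False
    obtain z where z: "\<And>y. y \<in> K \<Longrightarrow> u y \<le> u z"
      using continuous_attains_sup[OF K False continuous_on_subset[OF cont(1)]] by auto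
    show ?thesis using order_tendstoD(1)[OF lim less[of z]] by eventually_elim (use z in force)
  qed simp
  define r where "r k = 1 / (real k + 1) * g (\<gamma> (x k))" for k
  \<comment> \<open>Beyond this level both the bound on \<open>g t * h t\<close> and the
    differentiability of \<open>\<psi>\<close> and \<open>g\<close> are available; adding 1 keeps
    the level positive when \<open>T = 0\<close>.\<close>
  obtain K where K: "compact K" "\<And>x. x \<notin> K \<Longrightarrow> \<gamma> x > T + 1"
    using proper[of "T + 1"] h(3) by (auto simp: outside_compact_def)
  have cmp: "(\<forall>v. tdiff (atlas M) u (x k) v = r k * tdiff (atlas M) \<gamma> (x k) v) \<and>
      (\<forall>v. hessian M D u (x k) v v \<le> r k * hessian M D \<gamma> (x k) v v)" if k: "x k \<notin> K" for k
  proof -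
    have p: "\<gamma> (x k) > 0" using K(2)[OF k] h(3) by simp
    obtain d where d: "d \<le> 0" "(g has_real_derivative d) (at (\<gamma> (x k)))" using g(1)[OF p] by blast
    have "((\<lambda>t. 1 / (real k + 1) * g t) has_real_derivative 1 / (real k + 1) * d) (at (\<gamma> (x k)))"
      by (rule DERIV_cmult[OF d(2)])
    moreover have "((\<lambda>t. 1 / (real k + 1) * \<psi> t) has_real_derivative 1 / (real k + 1) * g t) (at t)"
      if "t \<in> {0<..}" for t
      using that by (intro DERIV_cmult \<psi>(5)) simp
    moreover have "1 / (real k + 1) * d \<le> 0" using d(1) by (simp add: mult_nonneg_nonpos divide_nonpos_pos)
    ultimately show ?thesis
      using hessian_comparison[OF at lc u(1) \<gamma>, of "{0<..}" "x k" "\<lambda>t. 1 / (real k + 1) * \<psi> t"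
          "\<lambda>t. 1 / (real k + 1) * g t" "1 / (real k + 1) * d"] p x
      unfolding r_def by auto
  qed
  show ?thesis
  proof (rule that[of x r])
    show "(\<lambda>k. u (x k)) \<longlonglongrightarrow> (SUP y. u y)" using lim by (simp add: S_def)
    show "r k \<ge> 0" for k using g(2) by (simp add: r_def)
    show "\<forall>\<^sub>F k in sequentially. r k = 0 \<or> x k \<notin> K'" if "compact K'" for K'
      using leave[OF that] by eventually_elim simp
    show "\<forall>\<^sub>F k in sequentially. \<forall>v. tdiff (atlas M) u (x k) v = r k * tdiff (atlas M) \<gamma> (x k) v"
      "\<forall>\<^sub>F k in sequentially. \<forall>v. hessian M D u (x k) v v \<le> r k * hessian M D \<gamma> (x k) v v"
      using leave[OF K(1)] by (auto elim!: eventually_mono dest!: cmp)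
    show "(\<lambda>k. r k * h (\<gamma> (x k))) \<longlonglongrightarrow> 0"
    proof (rule tendsto_sandwich[OF _ _ tendsto_const])
      show "\<forall>\<^sub>F k in sequentially. 0 \<le> r k * h (\<gamma> (x k))"
        using g(2) h(2) nonneg by (intro always_eventually) (simp add: r_def)
      show "\<forall>\<^sub>F k in sequentially. r k * h (\<gamma> (x k)) \<le> 1 / (real k + 1) * C"
        using leave[OF K(1)]
      proof eventually_elim
        case (elim k)
        have "g (\<gamma> (x k)) * h (\<gamma> (x k)) \<le> C" using h(1) K(2)[OF elim] by simp
        then have "1 / (real k + 1) * (g (\<gamma> (x k)) * h (\<gamma> (x k))) \<le> 1 / (real k + 1) * C"
          by (rule mult_left_mono) simp
        then show ?case by (simp add: r_def)
      qed
      show "(\<lambda>k. 1 / (real k + 1) * C) \<longlonglongrightarrow> 0"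
        using tendsto_mult_right[OF eps, of C] by simp
    qed
  qed
qed

lemma limsup_nonpos:
  fixes f s :: "nat \<Rightarrow> real"
  assumes "\<forall>\<^sub>F k in sequentially. f k \<le> c * s k" "s \<longlonglongrightarrow> 0"
  shows "limsup (\<lambda>k. ereal (f k)) \<le> 0"
proof -
  have "(\<lambda>k. ereal (c * s k)) \<longlonglongrightarrow> ereal (c * 0)"
    by (intro tendsto_intros assms(2))
  from lim_imp_Limsup[OF sequentially_bot this] have "limsup (\<lambda>k. ereal (c * s k)) = 0"
    by (simp add: zero_ereal_def)
  moreover have "limsup (\<lambda>k. ereal (f k)) \<le> limsup (\<lambda>k. ereal (c * s k))"
    using assms(1) by (intro Limsup_mono) (auto elim: eventually_mono)
  ultimately show ?thesis by simp
qed

theorem theorem3p1: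
  fixes M :: "('a::{t2_space, second_countable_topology}, 'n::finite) ph_structure"
    and D :: "'a \<Rightarrow> real ^ 'n \<Rightarrow> ('a \<Rightarrow> real ^ 'n) \<Rightarrow> real ^ 'n"
    and \<gamma> :: "'a \<Rightarrow> real"
    and G :: "real \<Rightarrow> real"
    and A B :: real
  assumes "pseudo_hermitian M"
    and "tanaka_webster M D"
    and "Ck_fun (atlas M) 2 UNIV \<gamma>"
    and "\<And>x. \<gamma> x \<ge> 0"
    and "\<And>\<eta>. \<eta> > 0 \<Longrightarrow> outside_compact (\<lambda>x. \<gamma> x > \<eta>)"
    and "A > 0" and "B > 0"
    and "smooth_on {0..} G"
    and "G 0 > 0"
    and "\<And>t. t \<ge> 0 \<Longrightarrow> vector_derivative G (at t within {0..}) \<ge> 0"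
    and "\<not> (\<exists>a\<ge>0. set_integrable lborel {a..} (\<lambda>t. G t powr (- 1 / 2)))"
    and "Limsup at_top (\<lambda>t. ereal (t * G (sqrt t) / G t)) < \<infinity>"
  shows
    "(outside_compact (\<lambda>x. webster_norm M x (hgradient M \<gamma> x) \<le> A * sqrt (\<gamma> x)) \<longrightarrow>
      outside_compact (\<lambda>x. sub_laplacian M D \<gamma> x \<le> B * sqrt (\<gamma> x) * sqrt (G (sqrt (\<gamma> x)))) \<longrightarrow>
      (\<forall>u. Ck_fun (atlas M) 2 UNIV u \<longrightarrow> bdd_above (range u) \<longrightarrow>
        (\<exists>x :: nat \<Rightarrow> 'a.
           (\<lambda>k. u (x k)) \<longlonglongrightarrow> (SUP y. u y) \<and>
           (\<lambda>k. webster_norm M (x k) (hgradient M u (x k))) \<longlonglongrightarrow> 0 \<and>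
           limsup (\<lambda>k. ereal (sub_laplacian M D u (x k))) \<le> 0)))
   \<and> (outside_compact (\<lambda>x. webster_norm M x (gradient M \<gamma> x) \<le> A * sqrt (\<gamma> x)) \<longrightarrow>
      outside_compact (\<lambda>x. sub_laplacian M D \<gamma> x \<le> B * sqrt (\<gamma> x) * sqrt (G (sqrt (\<gamma> x)))) \<longrightarrow>
      (\<forall>u. Ck_fun (atlas M) 2 UNIV u \<longrightarrow> bdd_above (range u) \<longrightarrow>
        (\<exists>x :: nat \<Rightarrow> 'a.
           (\<lambda>k. u (x k)) \<longlonglongrightarrow> (SUP y. u y) \<and>
           (\<lambda>k. webster_norm M (x k) (gradient M u (x k))) \<longlonglongrightarrow> 0 \<and>
           limsup (\<lambda>k. ereal (sub_laplacian M D u (x k))) \<le> 0)))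
   \<and> (outside_compact (\<lambda>x. webster_norm M x (hgradient M \<gamma> x) \<le> A * sqrt (\<gamma> x)) \<longrightarrow>
      outside_compact (\<lambda>x. \<forall>X\<in>T10 M x.
        re_hessian M D \<gamma> x X \<le> B * sqrt (\<gamma> x) * sqrt (G (sqrt (\<gamma> x))) * (webster_cnorm M x X)\<^sup>2) \<longrightarrow>
      (\<forall>u. Ck_fun (atlas M) 2 UNIV u \<longrightarrow> bdd_above (range u) \<longrightarrow>
        (\<exists>x :: nat \<Rightarrow> 'a.
           (\<lambda>k. u (x k)) \<longlonglongrightarrow> (SUP y. u y) \<and>
           (\<lambda>k. webster_norm M (x k) (hgradient M u (x k))) \<longlonglongrightarrow> 0 \<and>
           (\<forall>Y. (\<forall>k. Y k \<in> T10 M (x k) \<and> webster_cnorm M (x k) (Y k) = 1) \<longrightarrow>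
              limsup (\<lambda>k. ereal (re_hessian M D u (x k) (Y k))) \<le> 0))))
   \<and> (outside_compact (\<lambda>x. webster_norm M x (gradient M \<gamma> x) \<le> A * sqrt (\<gamma> x)) \<longrightarrow>
      outside_compact (\<lambda>x. \<forall>X\<in>T10 M x.
        re_hessian M D \<gamma> x X \<le> B * sqrt (\<gamma> x) * sqrt (G (sqrt (\<gamma> x))) * (webster_cnorm M x X)\<^sup>2) \<longrightarrow>
      (\<forall>u. Ck_fun (atlas M) 2 UNIV u \<longrightarrow> bdd_above (range u) \<longrightarrow>
        (\<exists>x :: nat \<Rightarrow> 'a.
           (\<lambda>k. u (x k)) \<longlonglongrightarrow> (SUP y. u y) \<and>
           (\<lambda>k. webster_norm M (x k) (gradient M u (x k))) \<longlonglongrightarrow> 0 \<and>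
           (\<forall>Y. (\<forall>k. Y k \<in> T10 M (x k) \<and> webster_cnorm M (x k) (Y k) = 1) \<longrightarrow>
              limsup (\<lambda>k. ereal (re_hessian M D u (x k) (Y k))) \<le> 0))))"
proof -
  interpret growth_function G
    by unfold_locales (use assms(8-11) in auto)
  note ph = assms(1)
  note at = pseudo_hermitian(1)[OF ph]
  have lc: "linear_connection (atlas M) D" using assms(2) by (simp add: tanaka_webster_def)
  define h where "h t = sqrt t * sqrt (G (sqrt t))" for t
  have h_nonneg: "h t \<ge> 0" if "t \<ge> 0" for t using that G_pos[of "sqrt t"] by (simp add: h_def)
  obtain C T where T: "T \<ge> 0" "\<And>t. t > T \<Longrightarrow> G t powr (- 1 / 2) * h t \<le> C"
    using growth_bound[OF assms(12)] unfolding h_def by metis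
  \<comment> \<open>The gradient bounds involve the square root of \<open>\<gamma>\<close> without
    the factor from \<open>G\<close>. Since that factor is at least \<open>sqrt (G 0)\<close>, the
    weight \<open>h\<close> covers them too.\<close>
  have sqrt_le: "sqrt t \<le> h t / sqrt (G 0)" if "t \<ge> 0" for t
  proof -
    have "sqrt t * sqrt (G 0) \<le> h t"
      unfolding h_def using G_mono[of 0 "sqrt t"] that by (intro mult_left_mono) auto
    then show ?thesis using pos0 by (simp add: pos_le_divide_eq)
  qed
  \<comment> \<open>The sequence is quantified outside the implications: it depends on none of the
    bounds, and each bound yields its own conclusion for it. The four claims are combinations of
    these implications.\<close>
  have main: "\<exists>x :: nat \<Rightarrow> 'a. (\<lambda>k. u (x k)) \<longlonglongrightarrow> (SUP y. u y) \<and>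
      (outside_compact (\<lambda>x. webster_norm M x (hgradient M \<gamma> x) \<le> A * sqrt (\<gamma> x)) \<longrightarrow>
        (\<lambda>k. webster_norm M (x k) (hgradient M u (x k))) \<longlonglongrightarrow> 0) \<and>
      (outside_compact (\<lambda>x. webster_norm M x (gradient M \<gamma> x) \<le> A * sqrt (\<gamma> x)) \<longrightarrow>
        (\<lambda>k. webster_norm M (x k) (gradient M u (x k))) \<longlonglongrightarrow> 0) \<and>
      (outside_compact (\<lambda>x. sub_laplacian M D \<gamma> x \<le> B * sqrt (\<gamma> x) * sqrt (G (sqrt (\<gamma> x)))) \<longrightarrow>
        limsup (\<lambda>k. ereal (sub_laplacian M D u (x k))) \<le> 0) \<and>
      (outside_compact (\<lambda>x. \<forall>X\<in>T10 M x.
        re_hessian M D \<gamma> x X \<le> B * sqrt (\<gamma> x) * sqrt (G (sqrt (\<gamma> x))) * (webster_cnorm M x X)\<^sup>2) \<longrightarrow>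
        (\<forall>Y. (\<forall>k. Y k \<in> T10 M (x k) \<and> webster_cnorm M (x k) (Y k) = 1) \<longrightarrow>
          limsup (\<lambda>k. ereal (re_hessian M D u (x k) (Y k))) \<le> 0))"
    if u: "Ck_fun (atlas M) 2 UNIV u" "bdd_above (range u)" for u
  proof -
    have g: "\<exists>d\<le>0. ((\<lambda>t. G t powr (- 1 / 2)) has_real_derivative d) (at t)" if "t > 0" for t
      using powr_deriv[OF that] by blast
    obtain x :: "nat \<Rightarrow> 'a" and r where x: "(\<lambda>k. u (x k)) \<longlonglongrightarrow> (SUP y. u y)"
      and r: "\<And>k. r k \<ge> 0"
      and leave: "\<And>K. compact K \<Longrightarrow> \<forall>\<^sub>F k in sequentially. r k = 0 \<or> x k \<notin> K"
      and rh: "(\<lambda>k. r k * h (\<gamma> (x k))) \<longlonglongrightarrow> 0"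
      and td: "\<forall>\<^sub>F k in sequentially. \<forall>v. tdiff (atlas M) u (x k) v = r k * tdiff (atlas M) \<gamma> (x k) v"
      and hess: "\<forall>\<^sub>F k in sequentially. \<forall>v. hessian M D u (x k) v v \<le> r k * hessian M D \<gamma> (x k) v v"
      by (rule maximizing_sequence[OF at lc u assms(3,4,5) \<psi>_continuous \<psi>_mono \<psi>_unbounded \<psi>_nonneg
        \<psi>_deriv g powr_ge_zero T(2) h_nonneg T(1)]) blast+
    \<comment> \<open>A bound on \<open>\<gamma>\<close> that fails on a compact set does no harm:
      the sequence has left that set, or the factor \<open>r k\<close> in front of the bound is
      0.\<close>
    have away: "\<forall>\<^sub>F k in sequentially. r k = 0 \<or> P (x k)" if P: "outside_compact P" for P
    proof -
      obtain K where "compact K" "\<And>x. x \<notin> K \<Longrightarrow> P x" using P by (auto simp: outside_compact_def)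
      then show ?thesis using leave[of K] by (auto elim: eventually_mono)
    qed
    \<comment> \<open>Stated for arbitrary fields \<open>V\<close> and \<open>W\<close> so as to
      cover full and horizontal gradients alike.\<close>
    have vanish: "(\<lambda>k. webster_norm M (x k) (W (x k))) \<longlonglongrightarrow> 0"
      if W: "\<forall>\<^sub>F k in sequentially. W (x k) = r k *\<^sub>R V (x k)"
        and V: "outside_compact (\<lambda>x. webster_norm M x (V x) \<le> A * sqrt (\<gamma> x))" for V W
    proof (rule tendsto_sandwich[OF _ _ tendsto_const])
      show "\<forall>\<^sub>F k in sequentially. 0 \<le> webster_norm M (x k) (W (x k))"
        by (intro always_eventually allI webster_norm_nonneg ph)
      show "\<forall>\<^sub>F k in sequentially. webster_norm M (x k) (W (x k)) \<le> A / sqrt (G 0) * (r k * h (\<gamma> (x k)))"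
        using W away[OF V]
      proof eventually_elim
        case (elim k)
        have "r k * webster_norm M (x k) (V (x k)) \<le> r k * (A * sqrt (\<gamma> (x k)))"
          using elim(2) r[of k] by (auto intro: mult_left_mono)
        also have "\<dots> \<le> r k * (A * (h (\<gamma> (x k)) / sqrt (G 0)))"
          using r assms(6) sqrt_le[OF assms(4)] by (intro mult_left_mono) auto
        finally show ?case using elim(1) r[of k] by (simp add: webster_norm_scaleR[OF ph] field_simps)
      qed
      show "(\<lambda>k. A / sqrt (G 0) * (r k * h (\<gamma> (x k)))) \<longlonglongrightarrow> 0"
        using tendsto_mult_left[OF rh, of "A / sqrt (G 0)"] by simp
    qed
    have grad: "\<forall>\<^sub>F k in sequentially. gradient M u (x k) = r k *\<^sub>R gradient M \<gamma> (x k)"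
      "\<forall>\<^sub>F k in sequentially. hgradient M u (x k) = r k *\<^sub>R hgradient M \<gamma> (x k)"
      using td by (auto elim!: eventually_mono intro!: gradient_scaleR[OF ph C2_linear_tdiff[OF at assms(3)]])
    have bil: "bilinear (hessian M D u y)" "bilinear (hessian M D \<gamma> y)" for y
      by (rule bilinear_hessian[OF at lc]; fact)+
    \<comment> \<open>\<open>F\<close> stands for either second-order quantity and \<open>Q\<close>
      for the vectors on which it is bounded. For the sub-Laplacian the vector argument is a dummy
      and \<open>Q\<close> is always true; for the complex Hessian \<open>Q\<close> selects the unit
      vectors of \<open>T10\<close>.\<close>
    have traces: "\<forall>\<^sub>F k in sequentially. F u (x k) (Y k) \<le> B * (r k * h (\<gamma> (x k)))"
      if le: "\<And>r y X. (\<And>v. hessian M D u y v v \<le> r * hessian M D \<gamma> y v v) \<Longrightarrow> F u y X \<le> r * F \<gamma> y X"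
        and F: "outside_compact (\<lambda>y. \<forall>X. Q y X \<longrightarrow> F \<gamma> y X \<le> B * h (\<gamma> y))"
        and Q: "\<And>k. Q (x k) (Y k)"
      for F :: "('a \<Rightarrow> real) \<Rightarrow> 'a \<Rightarrow> complex ^ 'n \<Rightarrow> real" and Q Y
      using hess away[OF F]
    proof eventually_elim
      case (elim k)
      have "F u (x k) (Y k) \<le> r k * F \<gamma> (x k) (Y k)" using le elim(1) by blast
      also have "\<dots> \<le> r k * (B * h (\<gamma> (x k)))" using elim(2) r[of k] Q by (auto intro: mult_left_mono)
      finally show ?case by (simp add: mult.left_commute)
    qed
    show ?thesis
    proof (intro exI[of _ x] conjI impI allI x)
      assume "outside_compact (\<lambda>x. webster_norm M x (hgradient M \<gamma> x) \<le> A * sqrt (\<gamma> x))"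
      then show "(\<lambda>k. webster_norm M (x k) (hgradient M u (x k))) \<longlonglongrightarrow> 0" by (rule vanish[OF grad(2)])
    next
      assume "outside_compact (\<lambda>x. webster_norm M x (gradient M \<gamma> x) \<le> A * sqrt (\<gamma> x))"
      then show "(\<lambda>k. webster_norm M (x k) (gradient M u (x k))) \<longlonglongrightarrow> 0" by (rule vanish[OF grad(1)])
    next
      assume "outside_compact (\<lambda>x. sub_laplacian M D \<gamma> x \<le> B * sqrt (\<gamma> x) * sqrt (G (sqrt (\<gamma> x))))"
      then have "\<forall>\<^sub>F k in sequentially. sub_laplacian M D u (x k) \<le> B * (r k * h (\<gamma> (x k)))"
        using traces[of "\<lambda>f y X. sub_laplacian M D f y" "\<lambda>y X. True"] hessian_traces_mono(1)[OF bil]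
        by (simp add: h_def mult.assoc)
      then show "limsup (\<lambda>k. ereal (sub_laplacian M D u (x k))) \<le> 0" using rh by (rule limsup_nonpos)
    next
      fix Y
      assume bound: "outside_compact (\<lambda>x. \<forall>X\<in>T10 M x.
          re_hessian M D \<gamma> x X \<le> B * sqrt (\<gamma> x) * sqrt (G (sqrt (\<gamma> x))) * (webster_cnorm M x X)\<^sup>2)"
        and Y: "\<forall>k. Y k \<in> T10 M (x k) \<and> webster_cnorm M (x k) (Y k) = 1"
      \<comment> \<open>On unit vectors the factor \<open>(webster_cnorm M y X)\<^sup>2\<close> is
        1, so the quadratic bound takes the common form required of \<open>F\<close>.\<close>
      have "outside_compact (\<lambda>y. \<forall>X. X \<in> T10 M y \<and> webster_cnorm M y X = 1 \<longrightarrow>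
          re_hessian M D \<gamma> y X \<le> B * h (\<gamma> y))"
        using bound by (fastforce simp: outside_compact_def h_def mult.assoc)
      then have "\<forall>\<^sub>F k in sequentially. re_hessian M D u (x k) (Y k) \<le> B * (r k * h (\<gamma> (x k)))"
        using traces[of "re_hessian M D" "\<lambda>y X. X \<in> T10 M y \<and> webster_cnorm M y X = 1" Y]
          hessian_traces_mono(2)[OF bil] Y by blast
      then show "limsup (\<lambda>k. ereal (re_hessian M D u (x k) (Y k))) \<le> 0" using rh by (rule limsup_nonpos)
    qed
  qed
  show ?thesis
    by (intro conjI impI allI; frule (1) main; blast)
qed

end
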